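(* Let $(W,S)$ be a finite Coxeter system, let $\mathbf{H}$ be the associated generic Iwahori-Hecke algebra over the field $\mathbf{K}$, with standard basis $\{T_w \mid w\in W\}$, and let $J\subset S$ be a subset such that $(S,J)$ is a Gelfand pair, i.e. the right $\mathbf{H}$-module $e_J\mathbf{H}$ is multiplicity-free. Let $e_J\mathbf{H}=\bigoplus_{i=1}^r V_i$ be its decomposition into simple $\mathbf{H}$-submodules, let $\chi_i$ be the character of $V_i$, let $c_i:=c_{V_i}\in\mathbf{K}$ be the Schur element of $V_i$, and let $$\omega_i := \chi_i^* e_J = e_J\chi_i^* \in \mathbf{H}\qquad (i=1,\dots,r)$$ be the zonal spherical functions of $(S,J)$, where $\chi_i^*=\sum_{w\in W}\chi_i(T_w)T_w^\vee$. Then: 1. If $\omega_i=\sum_{w\in W}\omega_i(w)T_w$ is the expansion of $\omega_i$ in the basis $\{T_w\mid w\in W\}$, then $\omega_i(e)=1$, where $e\in W$ is the unit element, for every $i=1,\dots,r$. 2. $\omega_i\omega_j=\delta_{i,j}\,c_i\,\omega_i$ for all $i,j=1,\dots,r$. 3. $\omega_i\in e_J\mathbf{H}e_J\cap V_i$ for every $i=1,\dots,r$. 4. The elements $\omega_1,\dots,\omega_r$ form a $\mathbf{K}$-basis of $e_J\mathbf{H}e_J$.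
   Context: **Generic Hecke algebra.** Let $(W,S)$ be a finite Coxeter system with length function $\ell$, and let $m_{st}$ denote the order of $st$ in $W$. Let $\{u_s\mid s\in S\}$ be indeterminates over $\mathbb{C}$ with $u_s=u_t$ whenever $s,t\in S$ are conjugate in $W$ (and otherwise algebraically independent). Let $\mathbf{K}\supset\mathbb{C}(u_s\mid s\in S)$ be a fixed finite Galois extension such that the following $\mathbf{K}$-algebra $\mathbf{H}$ is split semisimple (it is known that such an extension exists): $\mathbf{H}$ is the unital associative $\mathbf{K}$-algebra with generators $T_s$ ($s\in S$), subject to the quadratic relations $T_s^2=(u_s-1)T_s+u_s$ and the braid relations $T_sT_tT_s\cdots=T_tT_sT_t\cdots$ ($m_{st}$ factors on each side) for $s\neq t$. Split semisimple means that $\mathbf{H}$ is semisimple and $\operatorname{End}_{\mathbf{H}}(V)=\mathbf{K}$ for every simple module $V$. For a reduced expression $w=s_{1}\cdots s_{l}$ put $T_w:=T_{s_1}\cdots T_{s_l}$ and $u_w:=u_{s_1}\cdots u_{s_l}$; both are independent of the choice of reduced expression, $T_e=1$, and $\{T_w\mid w\in W\}$ is a $\mathbf{K}$-basis of $\mathbf{H}$. Modules are finite-dimensional right $\mathbf{H}$-modules. **Dual basis and the map $f\mapsto f^*$.** Put $T_w^\vee:=u_w^{-1}T_{w^{-1}}$. With the trace form $\tau:\mathbf{H}\to\mathbf{K}$, $\tau(T_e)=1$, $\tau(T_w)=0$ for $w\ne e$, one has $\tau(T_w^\vee T_{w'})=\delta_{w,w'}$. For a $\mathbf{K}$-linear map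 $f:\mathbf{H}\to\mathbf{K}$ define $f^*:=\sum_{w\in W}f(T_w)T_w^\vee\in\mathbf{H}$. The character of a module $V$ is $\chi_V(h):=\operatorname{tr}_V(h)$, the trace of the action of $h\in\mathbf{H}$ on $V$. Since $\chi_V$ is a trace function, $\chi_V^*$ lies in the center of $\mathbf{H}$. **Schur elements.** For a simple $\mathbf{H}$-module $V$, the Schur element $c_V\in\mathbf{K}$ is the unique element such that for every $\varphi\in\operatorname{End}_{\mathbf{K}}(V)$ and $v\in V$, $$\sum_{w\in W}\varphi(vT_w)T_w^\vee = c_V\operatorname{tr}_V(\varphi)\,v.$$ **Parabolic idempotent.** For $J\subset S$ let $W_J:=\langle J\rangle\subset W$, let $P_J:=\sum_{w\in W_J}u_w\in\mathbf{K}$ be the Poincaré polynomial of $W_J$, and let $$e_J:=\frac{1}{P_J}\sum_{w\in W_J}T_w\in\mathbf{H}.$$ This is an idempotent, namely the central primitive idempotent of the parabolic subalgebra $\mathbf{H}_J=\operatorname{span}_{\mathbf{K}}\{T_w\mid w\in W_J\}$ corresponding to the index representation $T_w\mapsto u_w$. **Gelfand pair.** $(S,J)$ is called a Gelfand pair if the right $\mathbf{H}$-module $e_J\mathbf{H}$ is multiplicity-free, i.e. every simple $\mathbf{H}$-module occurs in it with multiplicity at most one; equivalently, the representation of $W$ induced from the trivial representation of $W_J$ is multiplicity-free. In this case the simple summands $V_1,\dots,V_r\subset e_J\mathbf{H}$ are pairwise non-isomorphic and uniquely determined as submodules. *)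

theory Defs
  imports
    "HOL-Algebra.Algebra"
    "HOL-Algebra.Algebraic_Closure_Type"
    "HOL-Library.Poly_Mapping"
begin

section \<open>Finite Coxeter systems\<close>

abbreviation word_value :: "('w, 'b) monoid_scheme \<Rightarrow> 'w list \<Rightarrow> 'w" where
  "word_value W ws \<equiv> foldr (\<otimes>\<^bsub>W\<^esub>) ws \<one>\<^bsub>W\<^esub>"

text \<open>The congruence on words over \<open>S\<close> generated by the relations \<open>(s t)^m(s,t) = 1\<close>, where
  \<open>m(s,t)\<close> is the order of \<open>s t\<close> in \<open>W\<close> (an infinite order is represented by 0 and gives the
  empty relation). If all generators are involutions, then \<open>s s = 1\<close> is among the relations, so
  this monoid congruence is also the one that presents the group.\<close>

inductive coxeter_equiv :: "('w, 'b) monoid_scheme \<Rightarrow> 'w set \<Rightarrow> 'w list \<Rightarrow> 'w list \<Rightarrow> bool"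
  for W and S where
  refl: "coxeter_equiv W S ws ws"
| sym: "coxeter_equiv W S ws vs \<Longrightarrow> coxeter_equiv W S vs ws"
| trans: "coxeter_equiv W S ws vs \<Longrightarrow> coxeter_equiv W S vs us \<Longrightarrow> coxeter_equiv W S ws us"
| rel: "\<lbrakk>s \<in> S; t \<in> S; xs \<in> lists S; ys \<in> lists S\<rbrakk> \<Longrightarrow>
    coxeter_equiv W S (xs @ concat (replicate (group.ord W (s \<otimes>\<^bsub>W\<^esub> t)) [s, t]) @ ys) (xs @ ys)"

locale finite_coxeter_system = group W
  for W :: "('w, 'b) monoid_scheme" (structure) +
  fixes S :: "'w set"
  assumes finite_carrier: "finite (carrier W)"
    and S_subset: "S \<subseteq> carrier W"
    and S_involution: "s \<in> S \<Longrightarrow> s \<noteq> \<one> \<and> s \<otimes> s = \<one>"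
    and S_generates: "generate W S = carrier W"
    and presentation: "ws \<in> lists S \<Longrightarrow> word_value W ws = \<one> \<Longrightarrow> coxeter_equiv W S ws []"
begin

definition len :: "'w \<Rightarrow> nat" where
  "len w = (LEAST n. \<exists>ws \<in> lists S. length ws = n \<and> word_value W ws = w)"

definition reduced_word :: "'w \<Rightarrow> 'w list \<Rightarrow> bool" where
  "reduced_word w ws \<longleftrightarrow> ws \<in> lists S \<and> word_value W ws = w \<and> length ws = len w"

definition some_reduced_word :: "'w \<Rightarrow> 'w list" where
  "some_reduced_word w = (SOME ws. reduced_word w ws)"

definition conjugate :: "'w \<Rightarrow> 'w \<Rightarrow> bool" where
  "conjugate s t \<longleftrightarrow> (\<exists>g \<in> carrier W. t = g \<otimes> s \<otimes> inv g)"

end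

definition alternating_word :: "nat \<Rightarrow> 'w \<Rightarrow> 'w \<Rightarrow> 'w list" where
  "alternating_word m s t = map (\<lambda>i. if even i then s else t) [0..<m]"


section \<open>The field of parameters\<close>

abbreviation field_ring :: "'k::field ring" where
  "field_ring \<equiv> ring_of_type_algebra"

text \<open>A polynomial with variables in \<open>A\<close> is represented as a finitely supported function on
  monomials, the variables being the elements of \<open>A\<close> themselves.\<close>

definition algebraically_independent :: "('c::field \<Rightarrow> 'k::field) \<Rightarrow> 'k set \<Rightarrow> bool" where
  "algebraically_independent \<iota> A \<longleftrightarrow>
     (\<forall>p :: ('k \<Rightarrow>\<^sub>0 nat) \<Rightarrow>\<^sub>0 'c.
        (\<forall>m \<in> Poly_Mapping.keys p. Poly_Mapping.keys m \<subseteq> A) \<longrightarrow>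
        (\<Sum>m \<in> Poly_Mapping.keys p. \<iota> (Poly_Mapping.lookup p m) *
           (\<Prod>x \<in> Poly_Mapping.keys m. x ^ Poly_Mapping.lookup m x)) = 0 \<longrightarrow>
        p = 0)"

text \<open>\<open>UNIV :: 'k set\<close> as an extension of its subfield \<open>F\<close>. A finite extension is Galois iff
  \<open>F\<close> is the fixed field of its automorphism group.\<close>

definition finite_galois_over :: "'k::field set \<Rightarrow> bool" where
  "finite_galois_over F \<longleftrightarrow>
     ring.finite_dimension field_ring F (UNIV :: 'k set) \<and>
     {x. \<forall>\<sigma> \<in> ring_iso field_ring field_ring. (\<forall>y \<in> F. \<sigma> y = y) \<longrightarrow> \<sigma> x = x} = F"

locale hecke_parameters = finite_coxeter_system W S
  for W :: "('w, 'b) monoid_scheme" (structure) and S :: "'w set" +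
  fixes \<iota> :: "complex \<Rightarrow> 'k::field"
    and u :: "'w \<Rightarrow> 'k"
  assumes embedding: "\<iota> \<in> ring_hom field_ring field_ring"
    and u_eq_iff: "s \<in> S \<Longrightarrow> t \<in> S \<Longrightarrow> u s = u t \<longleftrightarrow> conjugate s t"
    and u_independent: "algebraically_independent \<iota> (u ` S)"
    and galois: "finite_galois_over (generate_field field_ring (range \<iota> \<union> u ` S))"
begin

text \<open>Elements of the free algebra on \<open>S\<close> are finitely supported functions on words. This is its
  two-sided ideal generated by the quadratic and braid relators; it is spanned by the products
  \<open>x r y\<close> with words \<open>x\<close>, \<open>y\<close> and a relator \<open>r\<close>.\<close>

inductive_set hecke_ideal :: "('w list \<Rightarrow>\<^sub>0 'k) set" where
  zero: "0 \<in> hecke_ideal"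
| quadratic: "\<lbrakk>f \<in> hecke_ideal; s \<in> S; x \<in> lists S; y \<in> lists S\<rbrakk> \<Longrightarrow>
    f + (Poly_Mapping.single (x @ [s, s] @ y) c
         - Poly_Mapping.single (x @ [s] @ y) (c * (u s - 1))
         - Poly_Mapping.single (x @ y) (c * u s)) \<in> hecke_ideal"
| braid: "\<lbrakk>f \<in> hecke_ideal; s \<in> S; t \<in> S; s \<noteq> t; x \<in> lists S; y \<in> lists S\<rbrakk> \<Longrightarrow>
    f + (Poly_Mapping.single (x @ alternating_word (ord (s \<otimes> t)) s t @ y) c
         - Poly_Mapping.single (x @ alternating_word (ord (s \<otimes> t)) t s @ y) c) \<in> hecke_ideal"

definition uw :: "'w \<Rightarrow> 'k" where
  "uw w = prod_list (map u (some_reduced_word w))"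

definition poincare :: "'w set \<Rightarrow> 'k" where
  "poincare J = (\<Sum>w \<in> generate W J. uw w)"

end


section \<open>Algebras and their finite-dimensional right modules\<close>

locale k_algebra = vector_space scale
  for scale :: "'k::field \<Rightarrow> 'h::ring_1 \<Rightarrow> 'h" (infixr \<open>*s\<close> 75) +
  assumes scale_mult_left: "(c *s x) * y = c *s (x * y)"
    and scale_mult_right: "x * (c *s y) = c *s (x * y)"
begin

text \<open>A module consists of a subspace \<open>V\<close> of the algebra and an arbitrary right action \<open>act\<close> on it,
  which need not be the multiplication. A simple module is isomorphic to a quotient of the regular
  module, so it can be carried by a linear complement of the submodule divided out; hence up to
  isomorphism all simple modules are of this form.\<close>

definition right_module :: "'h set \<Rightarrow> ('h \<Rightarrow> 'h \<Rightarrow> 'h) \<Rightarrow> bool" where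
  "right_module V act \<longleftrightarrow>
     (\<exists>B. finite B \<and> V = span B) \<and>
     (\<forall>v \<in> V. \<forall>h. act v h \<in> V) \<and>
     (\<forall>v \<in> V. \<forall>w \<in> V. \<forall>h. act (v + w) h = act v h + act w h) \<and>
     (\<forall>v \<in> V. \<forall>g h. act v (g + h) = act v g + act v h) \<and>
     (\<forall>c. \<forall>v \<in> V. \<forall>h. act (c *s v) h = c *s act v h \<and> act v (c *s h) = c *s act v h) \<and>
     (\<forall>v \<in> V. act v 1 = v) \<and>
     (\<forall>v \<in> V. \<forall>g h. act v (g * h) = act (act v g) h)"

definition submodule :: "'h set \<Rightarrow> 'h set \<Rightarrow> ('h \<Rightarrow> 'h \<Rightarrow> 'h) \<Rightarrow> bool" where
  "submodule U V act \<longleftrightarrow> U \<subseteq> V \<and> subspace U \<and> (\<forall>v \<in> U. \<forall>h. act v h \<in> U)"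

definition simple_module :: "'h set \<Rightarrow> ('h \<Rightarrow> 'h \<Rightarrow> 'h) \<Rightarrow> bool" where
  "simple_module V act \<longleftrightarrow> right_module V act \<and> V \<noteq> {0} \<and>
     (\<forall>U. submodule U V act \<longrightarrow> U = {0} \<or> U = V)"

definition linear_map :: "'h set \<Rightarrow> 'h set \<Rightarrow> ('h \<Rightarrow> 'h) \<Rightarrow> bool" where
  "linear_map V V' \<phi> \<longleftrightarrow>
     (\<forall>v \<in> V. \<phi> v \<in> V') \<and>
     (\<forall>v \<in> V. \<forall>w \<in> V. \<phi> (v + w) = \<phi> v + \<phi> w) \<and>
     (\<forall>c. \<forall>v \<in> V. \<phi> (c *s v) = c *s \<phi> v)"

definition module_map ::
    "'h set \<Rightarrow> ('h \<Rightarrow> 'h \<Rightarrow> 'h) \<Rightarrow> 'h set \<Rightarrow> ('h \<Rightarrow> 'h \<Rightarrow> 'h) \<Rightarrow> ('h \<Rightarrow> 'h) \<Rightarrow> bool" where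
  "module_map V act V' act' \<phi> \<longleftrightarrow>
     linear_map V V' \<phi> \<and> (\<forall>v \<in> V. \<forall>h. \<phi> (act v h) = act' (\<phi> v) h)"

definition isomorphic ::
    "'h set \<Rightarrow> ('h \<Rightarrow> 'h \<Rightarrow> 'h) \<Rightarrow> 'h set \<Rightarrow> ('h \<Rightarrow> 'h \<Rightarrow> 'h) \<Rightarrow> bool" where
  "isomorphic V act V' act' \<longleftrightarrow> (\<exists>\<phi>. module_map V act V' act' \<phi> \<and> bij_betw \<phi> V V')"

definition simple_decomposition ::
    "nat \<Rightarrow> (nat \<Rightarrow> 'h set) \<Rightarrow> 'h set \<Rightarrow> ('h \<Rightarrow> 'h \<Rightarrow> 'h) \<Rightarrow> bool" where
  "simple_decomposition n U M act \<longleftrightarrow>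
     (\<forall>i \<in> {1..n}. submodule (U i) M act \<and> simple_module (U i) act) \<and>
     M = {\<Sum>i\<in>{1..n}. v i | v. \<forall>i \<in> {1..n}. v i \<in> U i} \<and>
     (\<forall>v. (\<forall>i \<in> {1..n}. v i \<in> U i) \<longrightarrow> (\<Sum>i\<in>{1..n}. v i) = 0 \<longrightarrow> (\<forall>i \<in> {1..n}. v i = 0))"

definition split_semisimple :: bool where
  "split_semisimple \<longleftrightarrow>
     (\<exists>n U. simple_decomposition n U UNIV (*)) \<and>
     (\<forall>V act \<phi>. simple_module V act \<longrightarrow> module_map V act V act \<phi> \<longrightarrow>
        (\<exists>c. \<forall>v \<in> V. \<phi> v = c *s v))"

text \<open>For a semisimple module \<open>M\<close>. The multiplicity of \<open>V\<close> in \<open>M\<close> is the number of summands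
  isomorphic to \<open>V\<close> in a decomposition of \<open>M\<close> into simple submodules.\<close>

definition multiplicity_free :: "'h set \<Rightarrow> ('h \<Rightarrow> 'h \<Rightarrow> 'h) \<Rightarrow> bool" where
  "multiplicity_free M act \<longleftrightarrow>
     (\<forall>n U V act'. simple_decomposition n U M act \<longrightarrow> simple_module V act' \<longrightarrow>
        card {i \<in> {1..n}. isomorphic (U i) act V act'} \<le> 1)"

definition trace_on :: "'h set \<Rightarrow> ('h \<Rightarrow> 'h) \<Rightarrow> 'k" where
  "trace_on V \<phi> =
     (let B = (SOME B. independent B \<and> span B = V) in \<Sum>b \<in> B. representation B (\<phi> b) b)"

definition character :: "'h set \<Rightarrow> ('h \<Rightarrow> 'h \<Rightarrow> 'h) \<Rightarrow> 'h \<Rightarrow> 'k" where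
  "character V act h = trace_on V (\<lambda>v. act v h)"

end


section \<open>The generic Hecke algebra\<close>

text \<open>The algebra is the type \<open>'h\<close>, with generators \<open>T s\<close> for \<open>s \<in> S\<close>. It is given by generators
  and relations: it is generated by the \<open>T s\<close>, and the kernel of the evaluation map from the free
  algebra on \<open>S\<close> is the ideal of relations.\<close>

locale generic_hecke_algebra =
  hecke_parameters W S \<iota> u + k_algebra scale
  for W :: "('w, 'b) monoid_scheme" (structure) and S :: "'w set"
    and \<iota> :: "complex \<Rightarrow> 'k::field" and u :: "'w \<Rightarrow> 'k"
    and scale :: "'k \<Rightarrow> 'h::ring_1 \<Rightarrow> 'h" (infixr \<open>*s\<close> 75) +
  fixes T :: "'w \<Rightarrow> 'h"
  assumes T_generate: "\<exists>f. Poly_Mapping.keys f \<subseteq> lists S \<and>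
      h = (\<Sum>ws \<in> Poly_Mapping.keys f. Poly_Mapping.lookup f ws *s prod_list (map T ws))"
    and T_relations: "Poly_Mapping.keys f \<subseteq> lists S \<Longrightarrow>
      (\<Sum>ws \<in> Poly_Mapping.keys f. Poly_Mapping.lookup f ws *s prod_list (map T ws)) = 0
        \<longleftrightarrow> f \<in> hecke_ideal"
    and split_semisimple: "split_semisimple"
begin

definition Tw :: "'w \<Rightarrow> 'h" where
  "Tw w = prod_list (map T (some_reduced_word w))"

definition Tw_dual :: "'w \<Rightarrow> 'h" where
  "Tw_dual w = inverse (uw w) *s Tw (inv w)"

definition star :: "('h \<Rightarrow> 'k) \<Rightarrow> 'h" where
  "star f = (\<Sum>w \<in> carrier W. f (Tw w) *s Tw_dual w)"

definition schur_element :: "'h set \<Rightarrow> ('h \<Rightarrow> 'h \<Rightarrow> 'h) \<Rightarrow> 'k" where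
  "schur_element V act =
     (THE c. \<forall>\<phi>. linear_map V V \<phi> \<longrightarrow>
        (\<forall>v \<in> V. (\<Sum>w \<in> carrier W. act (\<phi> (act v (Tw w))) (Tw_dual w)) = (c * trace_on V \<phi>) *s v))"

definition e :: "'w set \<Rightarrow> 'h" where
  "e J = (1 / poincare J) *s (\<Sum>w \<in> generate W J. Tw w)"

definition eH :: "'w set \<Rightarrow> 'h set" where
  "eH J = {e J * h | h. True}"

definition eHe :: "'w set \<Rightarrow> 'h set" where
  "eHe J = {e J * h * e J | h. True}"

definition gelfand_pair :: "'w set \<Rightarrow> bool" where
  "gelfand_pair J \<longleftrightarrow> multiplicity_free (eH J) (*)"

end

end

theory Submission
  imports Defs
begin

text \<open>Write \<open>e = e\<^sub>J = d\<^sub>1 + \<dots> + d\<^sub>r\<close> along \<open>e H = V\<^sub>1 \<oplus> \<dots> \<oplus> V\<^sub>r\<close>. The \<open>d\<^sub>i\<close> are orthogonal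
  idempotents with \<open>V\<^sub>i = d\<^sub>i H\<close>. Left multiplication by \<open>d\<^sub>i h d\<^sub>j\<close> is a module map from \<open>V\<^sub>j\<close> to
  \<open>V\<^sub>i\<close>, so it vanishes for \<open>i \<noteq> j\<close> by multiplicity-freeness and is scalar for \<open>i = j\<close> by splitness.
  Hence \<open>d\<^sub>i h e\<close> is a multiple of \<open>d\<^sub>i\<close>, and the \<open>d\<^sub>i\<close> form a basis of \<open>e H e\<close>. The symmetrizing
  trace shows that \<open>\<chi>\<^sub>i\<^sup>*\<close> is central and acts on \<open>V\<^sub>j\<close> as \<open>\<delta>\<^sub>i\<^sub>j c\<^sub>i\<close>, so \<open>\<omega>\<^sub>i = c\<^sub>i d\<^sub>i\<close>. Finally
  \<open>\<omega>\<^sub>i(1) = \<tau>(\<chi>\<^sub>i\<^sup>* e) = \<chi>\<^sub>i(e) = 1\<close>, since \<open>v \<mapsto> v e\<close> is a projection of \<open>V\<^sub>i\<close> onto the line of \<open>d\<^sub>i\<close>.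
  In particular \<open>c\<^sub>i \<noteq> 0\<close>.

  Existence of the Schur element needs no density theorem: for \<open>a = d\<^sub>i a\<close> in \<open>V\<^sub>i\<close>, the Casimir identities move
  \<open>a\<close> and then \<open>d\<^sub>i\<close> from one tensor factor to the other, which reduces every rank-one map to a
  single one. The symmetrizing trace rests on the linear independence of the \<open>T\<^sub>w\<close>, for which the
  regular representation is constructed from the exchange condition and Matsumoto's theorem.\<close>


section \<open>Words in a Coxeter system\<close>

lemma alternating_word_0 [simp]: "alternating_word 0 s t = []"
  by (simp add: alternating_word_def)

lemma alternating_word_Suc: "alternating_word (Suc n) s t = s # alternating_word n t s"
proof -
  have "[0..<Suc n] = 0 # map Suc [0..<n]"
    by (simp add: upt_conv_Cons map_Suc_upt del: upt_Suc)
  then show ?thesis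
    by (simp add: alternating_word_def)
qed

lemma length_alternating_word [simp]: "length (alternating_word n s t) = n"
  by (simp add: alternating_word_def)

lemma alternating_word_double: "alternating_word (2 * n) s t = concat (replicate n [s, t])"
  by (induction n) (auto simp: alternating_word_Suc)

lemma alternating_word_in_lists: "s \<in> S \<Longrightarrow> t \<in> S \<Longrightarrow> alternating_word n s t \<in> lists S"
  by (auto simp: alternating_word_def)

context finite_coxeter_system
begin

text \<open>\<open>word_value\<close> abbreviates a \<open>foldr\<close>; splitting it over
  \<open>@\<close> by \<open>foldr_append\<close> would leave a fold that no longer starts from the
  unit, which \<open>word_value_append\<close> could not match.\<close>

declare foldr_append [simp del]
declare in_listsD [rule del] in_listsI [rule del]

lemma rev_in_lists [simp]: "rev ws \<in> lists A \<longleftrightarrow> ws \<in> lists A"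
  by (simp add: in_lists_conv_set)

lemma S_closed [simp]: "s \<in> S \<Longrightarrow> s \<in> carrier W"
  using S_subset by blast

lemma S_square [simp]: "s \<in> S \<Longrightarrow> s \<otimes> s = \<one>"
  using S_involution by blast

lemma S_inv [simp]: "s \<in> S \<Longrightarrow> inv s = s"
  by (simp add: inv_equality)

lemma S_cancel [simp]: "s \<in> S \<Longrightarrow> w \<in> carrier W \<Longrightarrow> s \<otimes> (s \<otimes> w) = w"
  by (metis S_closed S_square l_one m_assoc)

lemma S_cancel_right [simp]: "s \<in> S \<Longrightarrow> w \<in> carrier W \<Longrightarrow> w \<otimes> s \<otimes> s = w"
  by (simp add: m_assoc)

lemma word_value_closed [simp]: "ws \<in> lists S \<Longrightarrow> word_value W ws \<in> carrier W"
  by (induction ws) auto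

lemma word_value_append:
  "xs \<in> lists S \<Longrightarrow> ys \<in> lists S \<Longrightarrow> word_value W (xs @ ys) = word_value W xs \<otimes> word_value W ys"
proof (induction xs)
  case (Cons x xs)
  then show ?case by (simp add: m_assoc)
qed simp

lemma word_value_rev: "ws \<in> lists S \<Longrightarrow> word_value W (rev ws) = inv (word_value W ws)"
proof (induction ws)
  case (Cons s ws)
  then show ?case
    by (simp add: word_value_append inv_mult_group)
qed simp

lemma generate_word:
  assumes "J \<subseteq> S" "w \<in> generate W J"
  shows "\<exists>ws \<in> lists J. word_value W ws = w"
  using assms(2)
proof (induction rule: generate.induct)
  case one
  then show ?case by (intro bexI[of _ "[]"]) auto
next
  case (incl h)
  then show ?case using assms(1) by (intro bexI[of _ "[h]"]) auto
next
  case (inv h)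
  then show ?case using assms(1) by (intro bexI[of _ "[h]"]) auto
next
  case (eng h1 h2)
  then obtain xs ys where "xs \<in> lists J" "word_value W xs = h1" "ys \<in> lists J" "word_value W ys = h2"
    by blast
  with assms(1) show ?case
    by (intro bexI[of _ "xs @ ys"]) (auto simp: word_value_append in_lists_conv_set subset_eq)
qed

lemma word_exists: "w \<in> carrier W \<Longrightarrow> \<exists>ws \<in> lists S. word_value W ws = w"
  using generate_word[of S w] S_generates by blast


section \<open>The exchange condition\<close>

text \<open>For \<open>ws = s\<^sub>1 \<dots> s\<^sub>n\<close> this is the parity of the number of indices \<open>i\<close> with
  \<open>r = s\<^sub>1 \<dots> s\<^sub>i \<dots> s\<^sub>1\<close>. It depends only on the value of the word, because a relator \<open>(s t)^m\<close> runs
  through each of its reflections twice.\<close>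

fun reflection_parity :: "'w list \<Rightarrow> 'w \<Rightarrow> bool" where
  "reflection_parity [] r = False"
| "reflection_parity (s # ws) r = ((r = s) \<noteq> reflection_parity ws (s \<otimes> r \<otimes> s))"

text \<open>Cocycle rule: the reflections met in \<open>ys\<close> are conjugated by the value of
  \<open>xs\<close> when \<open>xs\<close> stands in front.\<close>

lemma reflection_parity_append:
  "xs \<in> lists S \<Longrightarrow> r \<in> carrier W \<Longrightarrow> reflection_parity (xs @ ys) r =
     (reflection_parity xs r \<noteq> reflection_parity ys (inv (word_value W xs) \<otimes> r \<otimes> word_value W xs))"
proof (induction xs arbitrary: r)
  case (Cons s xs)
  have "inv (word_value W (s # xs)) \<otimes> r \<otimes> word_value W (s # xs)
      = inv (word_value W xs) \<otimes> (s \<otimes> r \<otimes> s) \<otimes> word_value W xs"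
    using Cons.prems by (simp add: inv_mult_group m_assoc)
  with Cons show ?case by auto
qed simp

lemma mult_pow_swap:
  assumes "s \<in> S" "t \<in> S"
  shows "s \<otimes> (t \<otimes> s) [^] (n::nat) = (s \<otimes> t) [^] n \<otimes> s"
proof (induction n)
  case (Suc n)
  have "s \<otimes> (t \<otimes> s) [^] Suc n = (s \<otimes> (t \<otimes> s) [^] n) \<otimes> (t \<otimes> s)"
    using assms by (simp add: m_assoc)
  also have "\<dots> = (s \<otimes> t) [^] Suc n \<otimes> s"
    using assms unfolding Suc.IH by (simp add: m_assoc)
  finally show ?case .
qed (use assms in simp)

lemma pow_mult_conjugate:
  assumes "s \<in> S" "t \<in> S"
  shows "s \<otimes> ((t \<otimes> s) [^] (i::nat) \<otimes> t) \<otimes> s = (s \<otimes> t) [^] Suc i \<otimes> s"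
  using assms by (simp add: mult_pow_swap flip: m_assoc)

text \<open>The reflections met along s, t, s, ... are s, s t s, s t s t s, ..., that is
  \<open>(s \<otimes> t) [^] i \<otimes> s\<close>. Peeling off the first letter exchanges s and t
  and conjugates by s.\<close>

lemma reflection_parity_alternating:
  "s \<in> S \<Longrightarrow> t \<in> S \<Longrightarrow> r \<in> carrier W \<Longrightarrow>
    reflection_parity (alternating_word n s t) r = odd (card {i. i < n \<and> r = (s \<otimes> t) [^] i \<otimes> s})"
proof (induction n arbitrary: s t r)
  case (Suc n)
  have eq: "s \<otimes> r \<otimes> s = (t \<otimes> s) [^] i \<otimes> t \<longleftrightarrow> r = (s \<otimes> t) [^] Suc i \<otimes> s" for i
  proof -
    have "s \<otimes> r \<otimes> s = (t \<otimes> s) [^] i \<otimes> t \<longleftrightarrow> s \<otimes> (s \<otimes> r \<otimes> s) \<otimes> s = s \<otimes> ((t \<otimes> s) [^] i \<otimes> t) \<otimes> s"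
      using Suc.prems by (intro iffI) (simp, metis S_closed l_cancel m_closed nat_pow_closed r_cancel)
    also have "s \<otimes> (s \<otimes> r \<otimes> s) \<otimes> s = r"
      using Suc.prems by (simp add: m_assoc)
    finally show ?thesis
      using pow_mult_conjugate[OF Suc.prems(1,2)] by simp
  qed
  \<comment> \<open>The index 0 accounts for the first letter; the others are shifted by
    one.\<close>
  have "{i. i < Suc n \<and> r = (s \<otimes> t) [^] i \<otimes> s}
      = (if r = s then {0} else {}) \<union> Suc ` {i. i < n \<and> r = (s \<otimes> t) [^] Suc i \<otimes> s}" (is "?A = ?B \<union> Suc ` ?C")
    using Suc.prems by (auto simp: image_iff less_Suc_eq_0_disj)
  moreover have "card (?B \<union> Suc ` ?C) = card ?B + card ?C"
    by (subst card_Un_disjoint) (auto simp: card_image)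
  ultimately show ?case
    using Suc.prems by (simp add: alternating_word_Suc Suc.IH eq)
qed simp

lemma word_value_concat_replicate:
  "s \<in> S \<Longrightarrow> t \<in> S \<Longrightarrow> word_value W (concat (replicate n [s, t])) = (s \<otimes> t) [^] n"
  by (induction n) (auto simp: m_assoc[symmetric] simp flip: nat_pow_Suc2)

lemma reflection_parity_relator:
  assumes "s \<in> S" "t \<in> S" "r \<in> carrier W"
  shows "\<not> reflection_parity (concat (replicate (ord (s \<otimes> t)) [s, t])) r"
proof -
  let ?m = "ord (s \<otimes> t)" and ?P = "\<lambda>i. r = (s \<otimes> t) [^] i \<otimes> s"
  \<comment> \<open>Since \<open>(s \<otimes> t) [^] ?m\<close> is the unit, the second half of the
    relator repeats the reflections of the first, so every count is doubled.\<close>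
  have P: "?P (i + ?m) \<longleftrightarrow> ?P i" for i
    using assms by (simp add: pow_ord_eq_1 flip: nat_pow_mult)
  have eq: "{i. i < 2 * ?m \<and> ?P i} = {i. i < ?m \<and> ?P i} \<union> (\<lambda>i. i + ?m) ` {i. i < ?m \<and> ?P i}"
  proof (intro equalityI subsetI)
    fix i assume i: "i \<in> {i. i < 2 * ?m \<and> ?P i}"
    show "i \<in> {i. i < ?m \<and> ?P i} \<union> (\<lambda>i. i + ?m) ` {i. i < ?m \<and> ?P i}"
    proof (cases "i < ?m")
      case False
      then have "i = (i - ?m) + ?m" "i - ?m < ?m" using i by auto
      with i P[of "i - ?m"] show ?thesis by (auto intro!: image_eqI[of _ _ "i - ?m"])
    qed (use i in auto)
  qed (use P in auto)
  have "card {i. i < 2 * ?m \<and> ?P i} = 2 * card {i. i < ?m \<and> ?P i}"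
    unfolding eq by (subst card_Un_disjoint) (auto simp: card_image)
  then show ?thesis
    unfolding alternating_word_double[symmetric] reflection_parity_alternating[OF assms] by simp
qed

text \<open>The rules \<open>refl\<close>, \<open>sym\<close> and \<open>trans\<close> admit
  arbitrary words, so membership in \<open>lists S\<close> is carried through the induction next to
  the two parities.\<close>

lemma coxeter_equiv_invariants:
  assumes "coxeter_equiv W S ws vs"
  shows "(ws \<in> lists S \<longleftrightarrow> vs \<in> lists S) \<and> (ws \<in> lists S \<longrightarrow> even (length ws) = even (length vs) \<and>
    (\<forall>r \<in> carrier W. reflection_parity ws r = reflection_parity vs r))"
  using assms
proof (induction rule: coxeter_equiv.induct)
  case (rel s t xs ys)
  let ?c = "concat (replicate (ord (s \<otimes> t)) [s, t])"
  have c: "?c \<in> lists S" "word_value W ?c = \<one>" "even (length ?c)"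
    using rel alternating_word_in_lists[of s S t "2 * ord (s \<otimes> t)"]
    by (simp_all add: word_value_concat_replicate alternating_word_double length_concat sum_list_replicate)
  have "reflection_parity (xs @ ?c @ ys) r = reflection_parity (xs @ ys) r" if "r \<in> carrier W" for r
    using rel that c reflection_parity_relator[OF rel(1,2)]
    by (simp add: reflection_parity_append)
  with rel c show ?case by auto
qed auto

text \<open>Appending \<open>rev vs\<close> to both words gives words of value 1, to which
  \<open>presentation\<close> applies; the common suffix then cancels from both invariants.\<close>

lemma word_value_eq_invariants:
  assumes "ws \<in> lists S" "vs \<in> lists S" "word_value W ws = word_value W vs"
  shows "even (length ws) = even (length vs)"
    and "r \<in> carrier W \<Longrightarrow> reflection_parity ws r = reflection_parity vs r"
proof -
  have "coxeter_equiv W S (ws @ rev vs) []" "coxeter_equiv W S (vs @ rev vs) []"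
    using assms
    by (auto intro!: presentation simp: word_value_append word_value_rev)
  note inv = this[THEN coxeter_equiv_invariants]
  then show "even (length ws) = even (length vs)"
    using assms(1,2) by auto
  show "reflection_parity ws r = reflection_parity vs r" if "r \<in> carrier W"
  proof -
    have "\<not> reflection_parity (ws @ rev vs) r" "\<not> reflection_parity (vs @ rev vs) r"
      using inv that assms(1,2) by auto
    then show ?thesis
      using that assms by (auto simp: reflection_parity_append)
  qed
qed

text \<open>An odd count provides a position with
  \<open>r = s\<^sub>1 \<dots> s\<^sub>i \<dots> s\<^sub>1\<close>, and multiplication by this r
  deletes the letter \<open>s\<^sub>i\<close>. In the induction, passing the first letter conjugates
  r by it.\<close>

lemma reflection_parity_exchange:
  "ws \<in> lists S \<Longrightarrow> r \<in> carrier W \<Longrightarrow> reflection_parity ws r \<Longrightarrow>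
    \<exists>xs a ys. ws = xs @ a # ys \<and> r \<otimes> word_value W ws = word_value W (xs @ ys)"
proof (induction ws arbitrary: r)
  case (Cons s ws)
  show ?case
  proof (cases "r = s")
    case True
    with Cons.prems show ?thesis by (intro exI[of _ "[]"]) auto
  next
    case False
    with Cons.prems have "reflection_parity ws (s \<otimes> r \<otimes> s)" "s \<otimes> r \<otimes> s \<in> carrier W" "ws \<in> lists S"
      by auto
    with Cons.IH[of "s \<otimes> r \<otimes> s"] obtain xs a ys where "ws = xs @ a # ys"
      "s \<otimes> r \<otimes> s \<otimes> word_value W ws = word_value W (xs @ ys)" by blast
    moreover have "r \<otimes> (s \<otimes> word_value W ws) = s \<otimes> (s \<otimes> r \<otimes> s \<otimes> word_value W ws)"
      using Cons.prems by (simp add: m_assoc)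
    ultimately show ?thesis
      by (intro exI[of _ "s # xs"]) auto
  qed
qed simp

section \<open>Length and descents\<close>

lemma len_le: "ws \<in> lists S \<Longrightarrow> len (word_value W ws) \<le> length ws"
  unfolding len_def by (rule Least_le) auto

lemma reduced_word_exists: "w \<in> carrier W \<Longrightarrow> \<exists>ws. reduced_word w ws"
proof -
  assume "w \<in> carrier W"
  then have "\<exists>n. \<exists>ws \<in> lists S. length ws = n \<and> word_value W ws = w"
    using word_exists by blast
  from LeastI_ex[OF this] show ?thesis
    unfolding reduced_word_def len_def by blast
qed

lemma reduced_some_reduced_word: "w \<in> carrier W \<Longrightarrow> reduced_word w (some_reduced_word w)"
  unfolding some_reduced_word_def by (rule someI_ex[OF reduced_word_exists])

lemma len_parity: "ws \<in> lists S \<Longrightarrow> even (len (word_value W ws)) = even (length ws)"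
proof -
  assume ws: "ws \<in> lists S"
  then obtain vs where "reduced_word (word_value W ws) vs"
    using reduced_word_exists word_value_closed by blast
  with ws word_value_eq_invariants(1)[of vs ws] show ?thesis
    by (auto simp: reduced_word_def)
qed

lemma len_one [simp]: "len \<one> = 0"
  using len_le[of "[]"] by simp

lemma len_eq_0: "w \<in> carrier W \<Longrightarrow> len w = 0 \<longleftrightarrow> w = \<one>"
  using reduced_word_exists[of w] by (auto simp: reduced_word_def)

lemma len_inv_le: "w \<in> carrier W \<Longrightarrow> len (inv w) \<le> len w"
proof -
  assume "w \<in> carrier W"
  then obtain ws where "reduced_word w ws"
    using reduced_word_exists by blast
  with len_le[of "rev ws"] show ?thesis
    by (auto simp: reduced_word_def word_value_rev)
qed

lemma len_inv [simp]: "w \<in> carrier W \<Longrightarrow> len (inv w) = len w"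
  using len_inv_le[of w] len_inv_le[of "inv w"] by simp

lemma len_mult_le: "w \<in> carrier W \<Longrightarrow> v \<in> carrier W \<Longrightarrow> len (w \<otimes> v) \<le> len w + len v"
proof -
  assume "w \<in> carrier W" "v \<in> carrier W"
  then obtain ws vs where "reduced_word w ws" "reduced_word v vs"
    using reduced_word_exists by blast
  with len_le[of "ws @ vs"] show ?thesis
    by (auto simp: reduced_word_def word_value_append)
qed

lemma len_S: "s \<in> S \<Longrightarrow> len s \<le> 1"
  using len_le[of "[s]"] by simp

text \<open>The two lengths differ by at most one and have different parity.\<close>

lemma len_S_mult:
  assumes "s \<in> S" "w \<in> carrier W"
  shows "len (s \<otimes> w) = Suc (len w) \<or> len w = Suc (len (s \<otimes> w))"
proof -
  obtain ws where "reduced_word w ws"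
    using assms reduced_word_exists by blast
  then have "even (len (s \<otimes> w)) \<noteq> even (len w)"
    using len_parity[of "s # ws"] assms by (auto simp: reduced_word_def)
  moreover have "len (s \<otimes> w) \<le> Suc (len w)" "len w \<le> Suc (len (s \<otimes> w))"
    using len_mult_le[of s w] len_mult_le[of s "s \<otimes> w"] len_S[of s] assms by auto
  ultimately show ?thesis by presburger
qed

lemma len_mult_S_inv: "s \<in> S \<Longrightarrow> w \<in> carrier W \<Longrightarrow> len (w \<otimes> s) = len (s \<otimes> inv w)"
  using len_inv[of "w \<otimes> s"] by (simp add: inv_mult_group)

lemma len_mult_S:
  assumes "s \<in> S" "w \<in> carrier W"
  shows "len (w \<otimes> s) = Suc (len w) \<or> len w = Suc (len (w \<otimes> s))"
  using len_S_mult[of s "inv w"] assms by (simp add: len_mult_S_inv)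

lemma right_descent_exists:
  assumes "x \<in> carrier W" "len x = Suc n"
  obtains y t where "y \<in> carrier W" "t \<in> S" "x = y \<otimes> t" "len y = n"
proof -
  obtain xs where "reduced_word (inv x) xs"
    using assms reduced_word_exists inv_closed by blast
  then have xs: "xs \<in> lists S" "word_value W xs = inv x" "length xs = Suc n"
    using assms by (auto simp: reduced_word_def)
  then obtain t ts where t: "xs = t # ts" by (cases xs) auto
  define y where "y = inv (word_value W ts)"
  have y: "y \<in> carrier W" "t \<in> S" "len y \<le> n"
    using t xs len_le[of ts] by (auto simp: y_def)
  have "x = inv (inv x)" using assms by simp
  also have "\<dots> = y \<otimes> t"
    using t xs by (simp add: y_def inv_mult_group flip: xs(2))
  finally have "x = y \<otimes> t" .
  with y assms len_mult_S[of t y] that show thesis by auto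
qed

text \<open>The parity may be computed on a reduced word, where deleting a letter shortens; hence an
  odd count gives a descent.\<close>

lemma reflection_parity_iff_descent:
  assumes "ws \<in> lists S" "s \<in> S"
  shows "reflection_parity ws s \<longleftrightarrow> len (s \<otimes> word_value W ws) < len (word_value W ws)"
proof -
  have less: "len (s \<otimes> word_value W vs) < len (word_value W vs)"
    if vs: "vs \<in> lists S" "reflection_parity vs s" for vs
  proof -
    obtain us where us: "reduced_word (word_value W vs) us"
      using vs reduced_word_exists word_value_closed by blast
    then have "reflection_parity us s"
      using vs assms word_value_eq_invariants(2)[of us vs s] by (auto simp: reduced_word_def)
    with us assms obtain xs a ys where "us = xs @ a # ys"
      "s \<otimes> word_value W us = word_value W (xs @ ys)"
      using reflection_parity_exchange[of us s] by (auto simp: reduced_word_def)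
    with us show ?thesis
      using len_le[of "xs @ ys"] by (auto simp: reduced_word_def)
  qed
  show ?thesis
  proof
    assume *: "len (s \<otimes> word_value W ws) < len (word_value W ws)"
    show "reflection_parity ws s"
    proof (rule ccontr)
      assume "\<not> reflection_parity ws s"
      \<comment> \<open>If s is not counted in \<open>ws\<close>, it is counted in
        \<open>s # ws\<close>, so s shortens \<open>s \<otimes> word_value W ws\<close>, that is, it
        lengthens \<open>word_value W ws\<close>.\<close>
      then have "reflection_parity (s # ws) s" using assms by simp
      from less[OF _ this] assms * show False by simp
    qed
  qed (use less assms in auto)
qed

lemma exchange:
  assumes "ws \<in> lists S" "s \<in> S" "len (s \<otimes> word_value W ws) < len (word_value W ws)"
  obtains xs a ys where "ws = xs @ a # ys" "s \<otimes> word_value W ws = word_value W (xs @ ys)"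
  using assms reflection_parity_iff_descent[of ws s] reflection_parity_exchange[of ws s] by auto

text \<open>The reduced word is built letter by letter from a word over J. When a new letter causes
  a descent, the exchange condition only deletes a letter, so the alphabet J is kept.\<close>

lemma reduced_word_parabolic:
  assumes "J \<subseteq> S" "w \<in> generate W J"
  shows "\<exists>ws \<in> lists J. reduced_word w ws"
proof -
  have "ws \<in> lists J \<Longrightarrow> \<exists>vs \<in> lists J. reduced_word (word_value W ws) vs" for ws
  proof (induction ws)
    case Nil
    then show ?case by (intro bexI[of _ "[]"]) (auto simp: reduced_word_def)
  next
    case (Cons s ws)
    then obtain vs where vs: "vs \<in> lists J" "reduced_word (word_value W ws) vs" by auto
    have sS: "s \<in> S" "ws \<in> lists S" "vs \<in> lists S" using Cons.prems vs assms(1) lists_mono[OF assms(1)] by auto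
    show ?case
    proof (cases "len (s \<otimes> word_value W ws) < len (word_value W ws)")
      case True
      then obtain xs a ys where "vs = xs @ a # ys" "s \<otimes> word_value W vs = word_value W (xs @ ys)"
        using exchange[of vs s] vs sS by (auto simp: reduced_word_def)
      with True vs sS len_S_mult[of s "word_value W ws"] show ?thesis
        by (intro bexI[of _ "xs @ ys"]) (auto simp: reduced_word_def)
    next
      case False
      with vs sS len_S_mult[of s "word_value W ws"] Cons.prems show ?thesis
        by (intro bexI[of _ "s # vs"]) (auto simp: reduced_word_def)
    qed
  qed
  then show ?thesis using generate_word[OF assms] by blast
qed

text \<open>Exchange is applied to a reduced word of w followed by t: deleting the final t gives the
  claim, whereas deleting a letter of w would make \<open>s \<otimes> w\<close> shorter than
  w.\<close>

lemma square_eq: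
  assumes "s \<in> S" "t \<in> S" "w \<in> carrier W" "len (s \<otimes> w) > len w" "len (w \<otimes> t) > len w"
    "len (s \<otimes> w \<otimes> t) = len w"
  shows "s \<otimes> w = w \<otimes> t"
proof -
  obtain ws where ws: "reduced_word w ws"
    using assms reduced_word_exists by blast
  then have wt: "word_value W (ws @ [t]) = w \<otimes> t" "ws @ [t] \<in> lists S"
    using assms by (auto simp: reduced_word_def word_value_append)
  have "len (s \<otimes> word_value W (ws @ [t])) < len (word_value W (ws @ [t]))"
    unfolding wt using assms by (simp add: m_assoc)
  with exchange[OF wt(2) assms(1)] obtain xs a ys where
    x: "ws @ [t] = xs @ a # ys" "s \<otimes> (w \<otimes> t) = word_value W (xs @ ys)"
    unfolding wt by blast
  show ?thesis
  proof (cases ys rule: rev_cases)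
    case Nil
    with x ws have "s \<otimes> (w \<otimes> t) = w" by (auto simp: reduced_word_def)
    with assms show ?thesis by (metis S_closed S_cancel m_closed)
  next
    case (snoc zs b)
    with x have b: "ws = xs @ a # zs" "b = t" by auto
    then have "xs @ zs \<in> lists S" using ws by (auto simp: reduced_word_def)
    moreover from this x snoc b assms have "s \<otimes> w \<otimes> t = word_value W (xs @ zs) \<otimes> t"
      using word_value_append[of "xs @ zs" "[t]"] by (simp add: m_assoc)
    ultimately have "s \<otimes> w = word_value W (xs @ zs)"
      using assms by (meson S_closed m_closed r_cancel word_value_closed)
    with len_le[OF \<open>xs @ zs \<in> lists S\<close>] b ws assms show ?thesis by (auto simp: reduced_word_def)
  qed
qed


section \<open>Matsumoto's theorem\<close>

lemma ord_swap: "s \<in> S \<Longrightarrow> t \<in> S \<Longrightarrow> ord (t \<otimes> s) = ord (s \<otimes> t)"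
  using ord_inv[of "s \<otimes> t"] by (simp add: inv_mult_group)

text \<open>If s were a reflection of the word starting in t, then
  \<open>s = (t \<otimes> s) [^] i \<otimes> t\<close> with i < k, and
  \<open>(t \<otimes> s) [^] Suc i\<close> would be the unit although \<open>Suc i\<close> is below
  the order. So prefixing s lengthens.\<close>

lemma len_alternating_word:
  "s \<in> S \<Longrightarrow> t \<in> S \<Longrightarrow> k \<le> ord (s \<otimes> t) \<Longrightarrow> len (word_value W (alternating_word k s t)) = k"
proof (induction k arbitrary: s t)
  case (Suc k)
  have "s \<noteq> (t \<otimes> s) [^] i \<otimes> t" if "i < k" for i
  proof
    assume "s = (t \<otimes> s) [^] i \<otimes> t"
    then have "s \<otimes> s = (t \<otimes> s) [^] Suc i"
      using Suc.prems by (metis S_closed m_assoc m_closed nat_pow_Suc nat_pow_closed)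
    then have "(t \<otimes> s) [^] Suc i = \<one>"
      using Suc.prems by simp
    then have "ord (t \<otimes> s) dvd Suc i"
      using pow_eq_id[of "t \<otimes> s" "Suc i"] Suc.prems(1,2) by (meson S_closed m_closed)
    with that Suc.prems show False
      by (auto simp: ord_swap dest!: dvd_imp_le)
  qed
  then have none: "{i. i < k \<and> s = (t \<otimes> s) [^] i \<otimes> t} = {}" by auto
  then have "\<not> reflection_parity (alternating_word k t s) s"
    using reflection_parity_alternating[of t s s k] Suc.prems unfolding none by simp
  then show ?case
    using Suc reflection_parity_iff_descent[of "alternating_word k t s" s]
      len_S_mult[of s "word_value W (alternating_word k t s)"]
    by (auto simp: alternating_word_in_lists alternating_word_Suc ord_swap)
qed simp

text \<open>The reversal of one alternating word continues the other to the full relator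
  \<open>(s \<otimes> t) [^] ord (s \<otimes> t)\<close>, so each word is the inverse of the other's
  reversal.\<close>

lemma word_value_alternating_eq:
  assumes "s \<in> S" "t \<in> S"
  shows "word_value W (alternating_word (ord (s \<otimes> t)) s t)
       = word_value W (alternating_word (ord (s \<otimes> t)) t s)" proof -
  have split: "alternating_word (n + k) s t = alternating_word n s t @
      (if even n then alternating_word k s t else alternating_word k t s)" for n k s t
    by (induction n arbitrary: s t) (auto simp: alternating_word_Suc)
  have rev: "rev (alternating_word n s t) =
      (if odd n then alternating_word n s t else alternating_word n t s)" for n s t
  proof (induction n arbitrary: s t)
    case (Suc n)
    have "rev (alternating_word (Suc n) s t) = rev (alternating_word n t s) @ [s]"
      by (simp add: alternating_word_Suc)
    also have "\<dots> = (if odd n then alternating_word n t s else alternating_word n s t) @ [s]"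
      by (simp only: Suc)
    also have "\<dots> = (if odd (Suc n) then alternating_word (Suc n) s t else alternating_word (Suc n) t s)"
      using split[of n 1 s t] split[of n 1 t s] by (simp add: alternating_word_def[of "Suc 0"])
    finally show ?case .
  qed simp
  have lists: "alternating_word n s t \<in> lists S" "alternating_word n t s \<in> lists S" for n
    using assms by (auto simp: alternating_word_in_lists)
  let ?m = "ord (s \<otimes> t)"
  let ?a = "alternating_word ?m"
  have "?a s t @ rev (?a t s) = alternating_word (2 * ?m) s t"
    using split[of ?m ?m s t] by (simp add: rev mult_2)
  then have "word_value W (?a s t @ rev (?a t s)) = \<one>"
    using assms
    by (simp add: alternating_word_double word_value_concat_replicate pow_ord_eq_1)
  then have "word_value W (?a s t) \<otimes> inv (word_value W (?a t s)) = \<one>"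
    using lists word_value_rev[of "?a t s"] word_value_append[of "?a s t" "rev (?a t s)"]
    by (auto simp: in_lists_conv_set)
  then show ?thesis
    using lists by (metis inv_closed inv_equality inv_inv word_value_closed)
qed

text \<open>Induction extends the alternating prefix at its front. The prefix of length k starting
  in t comes from the hypothesis with s and t exchanged; as s is a descent, exchange deletes one
  letter of the factorization.\<close>

lemma alternating_prefix:
  assumes "s \<in> S" "t \<in> S" "w \<in> carrier W" "len (s \<otimes> w) < len w" "len (t \<otimes> w) < len w"
    "k \<le> ord (s \<otimes> t)"
  shows "\<exists>v \<in> carrier W. w = word_value W (alternating_word k s t) \<otimes> v \<and> len w = k + len v"
  using assms
proof (induction k arbitrary: s t)
  case 0
  then show ?case by auto
next
  case (Suc k)
  then have "k \<le> ord (t \<otimes> s)" by (simp add: ord_swap)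
  with Suc.prems obtain v where v: "v \<in> carrier W" "w = word_value W (alternating_word k t s) \<otimes> v"
      "len w = k + len v"
    using Suc.IH[of t s] by blast
  obtain vs where vs: "reduced_word v vs" using v reduced_word_exists by blast
  let ?a = "alternating_word k t s"
  have a: "?a \<in> lists S" "vs \<in> lists S" "word_value W vs = v" "length vs = len v"
    using Suc.prems vs by (auto simp: alternating_word_in_lists reduced_word_def)
  then have w: "word_value W (?a @ vs) = w"
    using v by (simp add: word_value_append)
  with Suc.prems a exchange[of "?a @ vs" s] obtain xs b ys where
    x: "?a @ vs = xs @ b # ys" "s \<otimes> w = word_value W (xs @ ys)" by (metis append_in_lists_conv)
  from x(1) consider zs where "?a = xs @ b # zs" "ys = zs @ vs"
    | zs where "xs = ?a @ zs" "vs = zs @ b # ys"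
    by (auto simp: append_eq_append_conv2 append_eq_Cons_conv)
  then show ?case
  proof cases
    case 1
    \<comment> \<open>Deletion inside the prefix would write the alternating word of length
      \<open>Suc k\<close>, which is reduced, with fewer than k letters.\<close>
    then have zs: "xs @ zs \<in> lists S" "length (xs @ zs) < k"
      using a(1) length_alternating_word[of k t s] by (auto simp del: length_alternating_word)
    have "s \<otimes> word_value W ?a \<otimes> v = word_value W (xs @ zs) \<otimes> v"
      using x(2) 1 zs a v word_value_append[of "xs @ zs" vs] Suc.prems by (simp add: m_assoc)
    then have "word_value W (alternating_word (Suc k) s t) = word_value W (xs @ zs)"
      using zs a v Suc.prems
      by (simp add: alternating_word_Suc)
    then have "Suc k \<le> length (xs @ zs)"
      using len_alternating_word[of s t "Suc k"] Suc.prems len_le[OF zs(1)] by simp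
    with zs show ?thesis by simp
  next
    case 2
    \<comment> \<open>Deletion in the tail makes room for s in front: the prefix grows by one and
      the tail shrinks by one.\<close>
    then have zs: "zs @ ys \<in> lists S" "len v = Suc (length (zs @ ys))" using a by auto
    let ?v = "word_value W (zs @ ys)"
    have "s \<otimes> w = word_value W ?a \<otimes> ?v"
      using x(2) 2 word_value_append[of ?a "zs @ ys"] a zs by simp
    then have eq: "w = word_value W (alternating_word (Suc k) s t) \<otimes> ?v"
      using Suc.prems a zs
      by (simp add: alternating_word_Suc m_assoc)
        (metis S_cancel)
    have "len w \<le> Suc k + len ?v"
      using Suc.prems zs len_mult_le[of "word_value W (alternating_word (Suc k) s t)" ?v]
        len_le[of "alternating_word (Suc k) s t"]
      by (simp add: eq[symmetric] alternating_word_in_lists)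
    with zs len_le[OF zs(1)] v have "len w = Suc k + len ?v" by simp
    with eq zs(1) show ?thesis by (metis word_value_closed)
  qed
qed

text \<open>Words with the same first letter are compared by their tails. If the first letters s and
  t differ, both are descents, so w begins with both alternating words of full length;
  \<open>ws\<close> is linked to the one in s, \<open>vs\<close> to the one in t, and
  \<open>braid\<close> links these two.\<close>

lemma matsumoto:
  fixes f :: "'w \<Rightarrow> 'm::monoid_mult"
  assumes braid: "\<And>s t. s \<in> S \<Longrightarrow> t \<in> S \<Longrightarrow> s \<noteq> t \<Longrightarrow>
      prod_list (map f (alternating_word (ord (s \<otimes> t)) s t))
    = prod_list (map f (alternating_word (ord (s \<otimes> t)) t s))"
    and "reduced_word w ws" "reduced_word w vs"
  shows "prod_list (map f ws) = prod_list (map f vs)"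
  using assms(2,3)
proof (induction "length ws" arbitrary: w ws vs)
  case 0
  then show ?case by (auto simp: reduced_word_def)
next
  case (Suc n)
  then obtain s ws' t vs' where ws: "ws = s # ws'" and vs: "vs = t # vs'"
    by (metis Zero_not_Suc length_0_conv list.exhaust reduced_word_def)
  have red: "ws \<in> lists S" "vs \<in> lists S" "word_value W ws = w" "word_value W vs = w"
    "len w = Suc n" "length vs = Suc n" "length ws = Suc n"
    using Suc by (auto simp: reduced_word_def)
  have tail: "prod_list (map f (x # xs)) = prod_list (map f (x # ys))"
    if "reduced_word w (x # xs)" "reduced_word w (x # ys)" for x xs ys
  proof -
    have x: "x \<in> S" "xs \<in> lists S" "ys \<in> lists S" "length xs = n" "length ys = n"
      "x \<otimes> word_value W xs = w" "x \<otimes> word_value W ys = w"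
      using that red by (auto simp: reduced_word_def)
    then have eq: "word_value W xs = word_value W ys"
      by (metis S_cancel word_value_closed)
    have "len w \<le> Suc (len (word_value W xs))"
      using x len_S_mult[of x "word_value W xs"] by auto
    then have "len (word_value W xs) = n"
      using x len_le[of xs] red by simp
    with x eq have "reduced_word (word_value W xs) xs" "reduced_word (word_value W xs) ys"
      by (auto simp: reduced_word_def)
    from Suc.hyps(1)[OF x(4)[symmetric] this] show ?thesis by simp
  qed
  show ?case
  proof (cases "s = t")
    case True
    then show ?thesis using tail Suc.prems ws vs by blast
  next
    case False
    have st: "s \<in> S" "t \<in> S" using red ws vs by auto
    let ?m = "ord (s \<otimes> t)"
    have w: "w \<in> carrier W" using red by auto
    have "s \<otimes> (s \<otimes> word_value W ws') = word_value W ws'" "t \<otimes> (t \<otimes> word_value W vs') = word_value W vs'"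
      using red(1,2) st unfolding ws vs by simp_all
    moreover have "s \<otimes> word_value W ws' = w" "t \<otimes> word_value W vs' = w"
      using red(3,4) unfolding ws vs by simp_all
    ultimately have "s \<otimes> w = word_value W ws'" "t \<otimes> w = word_value W vs'"
      by metis+
    then have "len (s \<otimes> w) < len w" "len (t \<otimes> w) < len w"
      using len_le[of ws'] len_le[of vs'] red unfolding ws vs by auto
    then obtain v where v: "v \<in> carrier W" "w = word_value W (alternating_word ?m s t) \<otimes> v"
        "len w = ?m + len v"
      using alternating_prefix[of s t w ?m] st w by auto
    obtain ys where "reduced_word v ys" using v reduced_word_exists by blast
    then have r: "reduced_word w (alternating_word ?m s t @ ys)" "reduced_word w (alternating_word ?m t s @ ys)"
      using v st word_value_alternating_eq[OF st]
      by (auto simp: reduced_word_def alternating_word_in_lists word_value_append)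
    \<comment> \<open>A positive order, due to finiteness, ensures that the alternating words have a
      first letter for \<open>tail\<close> to work with.\<close>
    have "?m \<noteq> 0"
      using st finite_carrier ord_ge_1[of "s \<otimes> t"] by auto
    then obtain m where m: "?m = Suc m" using not0_implies_Suc by blast
    have "prod_list (map f ws) = prod_list (map f (alternating_word ?m s t @ ys))"
      using tail[of s] r(1) Suc.prems(1) unfolding ws m alternating_word_Suc by simp
    also have "\<dots> = prod_list (map f (alternating_word ?m t s @ ys))"
      using braid[OF st False] by simp
    also have "\<dots> = prod_list (map f vs)"
      using tail[of t] r(2) Suc.prems(2) unfolding vs m alternating_word_Suc by simp
    finally show ?thesis .
  qed
qed

end

section \<open>Parameters and the regular representation\<close>

text \<open>\<open>F k a\<close> is the contribution of the coefficient a at k. Supports change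
  under addition, so sums over \<open>keys\<close> are compared on a common finite superset, padded
  by \<open>F k 0 = 0\<close>.\<close>

lemma sum_keys_superset:
  fixes F :: "'a \<Rightarrow> 'b::zero \<Rightarrow> 'c::comm_monoid_add"
  assumes "\<And>k. F k 0 = 0" "finite A" "Poly_Mapping.keys p \<subseteq> A"
  shows "(\<Sum>k \<in> Poly_Mapping.keys p. F k (Poly_Mapping.lookup p k)) = (\<Sum>k \<in> A. F k (Poly_Mapping.lookup p k))"
  using assms by (intro sum.mono_neutral_left) (auto simp: in_keys_iff)

lemma sum_keys_single:
  assumes "F k 0 = 0"
  shows "(\<Sum>k' \<in> Poly_Mapping.keys (Poly_Mapping.single k a). F k' (Poly_Mapping.lookup (Poly_Mapping.single k a) k')) = F k a"
  using assms by auto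

lemma sum_keys_add:
  fixes F :: "'a \<Rightarrow> 'b::comm_monoid_add \<Rightarrow> 'c::comm_monoid_add"
  assumes "\<And>k. F k 0 = 0" "\<And>k a b. F k (a + b) = F k a + F k b"
  shows "(\<Sum>k \<in> Poly_Mapping.keys (p + q). F k (Poly_Mapping.lookup (p + q) k)) =
    (\<Sum>k \<in> Poly_Mapping.keys p. F k (Poly_Mapping.lookup p k)) +
    (\<Sum>k \<in> Poly_Mapping.keys q. F k (Poly_Mapping.lookup q k))"
proof -
  let ?A = "Poly_Mapping.keys p \<union> Poly_Mapping.keys q"
  show ?thesis
    using Poly_Mapping.keys_add[of p q] sum_keys_superset[of F ?A "p + q"]
      sum_keys_superset[of F ?A p] sum_keys_superset[of F ?A q]
    by (simp add: assms lookup_add sum.distrib)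
qed

lemma sum_keys_diff:
  fixes F :: "'a \<Rightarrow> 'b::ab_group_add \<Rightarrow> 'c::ab_group_add"
  assumes "\<And>k a b. F k (a + b) = F k a + F k b"
  shows "(\<Sum>k \<in> Poly_Mapping.keys (p - q). F k (Poly_Mapping.lookup (p - q) k)) =
    (\<Sum>k \<in> Poly_Mapping.keys p. F k (Poly_Mapping.lookup p k)) -
    (\<Sum>k \<in> Poly_Mapping.keys q. F k (Poly_Mapping.lookup q k))"
proof -
  have 0: "F k 0 = 0" for k
    using assms[of k 0 0] by simp
  show ?thesis
    using sum_keys_add[of F "p - q" q] by (simp add: 0 assms)
qed

lemma sum_keys_sum:
  fixes F :: "'a \<Rightarrow> 'b::comm_monoid_add \<Rightarrow> 'c::comm_monoid_add"
  assumes "\<And>k. F k 0 = 0" "\<And>k a b. F k (a + b) = F k a + F k b"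
  shows "(\<Sum>k \<in> Poly_Mapping.keys (\<Sum>i\<in>I. p i). F k (Poly_Mapping.lookup (\<Sum>i\<in>I. p i) k)) =
    (\<Sum>i\<in>I. \<Sum>k \<in> Poly_Mapping.keys (p i). F k (Poly_Mapping.lookup (p i) k))"
  by (induction I rule: infinite_finite_induct) (simp_all add: sum_keys_add[of F] assms)

context hecke_parameters
begin

lemma embedding_one: "\<iota> 1 = 1"
  using ring_hom_one[OF embedding] by (simp add: ring_of_type_algebra_def)

lemma embedding_add: "\<iota> (a + b) = \<iota> a + \<iota> b"
  using ring_hom_add[OF embedding, of a b] by (simp add: ring_of_type_algebra_def)

lemma embedding_zero: "\<iota> 0 = 0"
  using embedding_add[of 0 0] by (metis add.right_neutral add_left_cancel)

text \<open>Otherwise the polynomial consisting of the single variable \<open>u s\<close> would be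
  an algebraic relation.\<close>

lemma u_nonzero: "s \<in> S \<Longrightarrow> u s \<noteq> 0"
proof
  assume s: "s \<in> S" "u s = 0"
  define m where "m = Poly_Mapping.single (u s) (1::nat)"
  define p where "p = Poly_Mapping.single m (1::complex)"
  have keys: "Poly_Mapping.keys p = {m}" "Poly_Mapping.keys m = {u s}" by (simp_all add: p_def m_def)
  then have "(\<Sum>m \<in> Poly_Mapping.keys p. \<iota> (Poly_Mapping.lookup p m) *
      (\<Prod>x \<in> Poly_Mapping.keys m. x ^ Poly_Mapping.lookup m x)) = 0"
    unfolding keys by (simp add: keys m_def s)
  moreover have "\<forall>m \<in> Poly_Mapping.keys p. Poly_Mapping.keys m \<subseteq> u ` S"
    using s keys by auto
  ultimately have "p = 0"
    using u_independent unfolding algebraically_independent_def by blast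
  with keys show False by simp
qed

text \<open>For order 2n + 1 the braid relation reads \<open>s \<otimes> (t \<otimes> s) [^] n = t
  \<otimes> (s \<otimes> t) [^] n\<close>, so \<open>(s \<otimes> t) [^] n\<close> conjugates s into
  t.\<close>

lemma odd_ord_conjugate:
  assumes "s \<in> S" "t \<in> S" "odd (ord (s \<otimes> t))"
  shows "conjugate s t"
proof -
  from assms(3) obtain n where n: "ord (s \<otimes> t) = Suc (2 * n)" by (auto elim: oddE)
  let ?c = "s \<otimes> t"
  have c: "?c \<in> carrier W" using assms by simp
  have "t \<otimes> ?c [^] n = ?c [^] n \<otimes> s"
  proof -
    have "s \<otimes> (t \<otimes> ?c [^] n) = s \<otimes> (s \<otimes> (t \<otimes> s) [^] n)"
      using word_value_alternating_eq[OF assms(1,2)] assms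
      by (simp add: n alternating_word_Suc alternating_word_double word_value_concat_replicate)
    then show ?thesis
      using assms by (simp add: mult_pow_swap)
  qed
  then have "t = ?c [^] n \<otimes> s \<otimes> inv (?c [^] n)"
    using assms inv_solve_right[of t "?c [^] n \<otimes> s" "?c [^] n"] by simp
  with c show ?thesis
    unfolding conjugate_def by blast
qed

text \<open>For odd order the two parameters coincide by conjugacy; for even order both letters
  occur equally often in either word.\<close>

lemma u_braid:
  assumes "s \<in> S" "t \<in> S"
  shows "prod_list (map u (alternating_word (ord (s \<otimes> t)) s t))
    = prod_list (map u (alternating_word (ord (s \<otimes> t)) t s))"
proof (cases "odd (ord (s \<otimes> t))")
  case True
  then have "u s = u t"
    using odd_ord_conjugate u_eq_iff assms by blast
  then have "map u (alternating_word n s t) = map u (alternating_word n t s)" for n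
    by (simp add: alternating_word_def)
  then show ?thesis by simp
next
  case False
  then obtain n where n: "ord (s \<otimes> t) = 2 * n" by auto
  moreover have "prod_list (map u (concat (replicate n [s, t]))) = (u s * u t) ^ n" for s t
    by (induction n) (simp_all add: mult.assoc)
  ultimately show ?thesis
    unfolding n alternating_word_double by (simp add: mult.commute)
qed

lemma uw_reduced_word: "reduced_word w ws \<Longrightarrow> uw w = prod_list (map u ws)"
proof -
  assume ws: "reduced_word w ws"
  then have "w \<in> carrier W" by (auto simp: reduced_word_def)
  from matsumoto[of u, OF u_braid reduced_some_reduced_word[OF this] ws] show ?thesis
    by (simp add: uw_def)
qed

lemma uw_one [simp]: "uw \<one> = 1"
  using uw_reduced_word[of \<one> "[]"] by (simp add: reduced_word_def)

lemma reduced_word_Cons: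
  assumes "s \<in> S" "reduced_word w ws" "len w < len (s \<otimes> w)"
  shows "reduced_word (s \<otimes> w) (s # ws)"
  using assms len_S_mult[of s w] by (auto simp: reduced_word_def)

lemma uw_mult:
  assumes "s \<in> S" "w \<in> carrier W" "len w < len (s \<otimes> w)"
  shows "uw (s \<otimes> w) = u s * uw w"
proof -
  obtain ws where ws: "reduced_word w ws" using assms reduced_word_exists by blast
  show ?thesis
    using uw_reduced_word[OF reduced_word_Cons[OF assms(1) ws assms(3)]] uw_reduced_word[OF ws] by simp
qed

lemma uw_nonzero: "w \<in> carrier W \<Longrightarrow> uw w \<noteq> 0"
  using reduced_some_reduced_word[of w] u_nonzero
  by (auto simp: uw_def reduced_word_def prod_list_zero_iff in_lists_conv_set)

lemma uw_inv: "w \<in> carrier W \<Longrightarrow> uw (inv w) = uw w"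
proof -
  assume "w \<in> carrier W"
  then obtain ws where ws: "reduced_word w ws" using reduced_word_exists by blast
  then have "reduced_word (inv w) (rev ws)"
    using word_value_rev[of ws] by (auto simp: reduced_word_def)
  from uw_reduced_word[OF this] uw_reduced_word[OF ws] show ?thesis
    by (simp flip: rev_map add: prod_list.rev)
qed

text \<open>\<open>P\<^sub>J\<close> is the value of a polynomial whose constant coefficient is 1, the contribution of
  the identity alone.\<close>

lemma poincare_nonzero:
  assumes "J \<subseteq> S"
  shows "poincare J \<noteq> 0"
proof
  assume zero: "poincare J = 0"
  let ?F = "\<lambda>m a. \<iota> a * (\<Prod>x \<in> Poly_Mapping.keys m. x ^ Poly_Mapping.lookup m x)"
  \<comment> \<open>\<open>mon ws\<close> is the exponent vector of the monomial of a word. The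
    variables are the values \<open>u s\<close> themselves, so conjugate generators share a
    variable.\<close>
  define mon where "mon ws = (\<Sum>s\<leftarrow>ws. Poly_Mapping.single (u s) (1::nat))" for ws
  have prod_mon: "(\<Prod>x \<in> Poly_Mapping.keys (mon ws). x ^ Poly_Mapping.lookup (mon ws) x) = prod_list (map u ws)"
    for ws
  proof (induction ws)
    case (Cons s ws)
    have superset: "(\<Prod>x \<in> Poly_Mapping.keys m. x ^ Poly_Mapping.lookup m x) = (\<Prod>x \<in> A. x ^ Poly_Mapping.lookup m x)"
      if "finite A" "Poly_Mapping.keys m \<subseteq> A" for A and m :: "'k \<Rightarrow>\<^sub>0 nat"
      using that by (intro prod.mono_neutral_left) (auto simp: in_keys_iff)
    let ?m = "Poly_Mapping.single (u s) (1::nat)" and ?n = "mon ws"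
    let ?A = "insert (u s) (Poly_Mapping.keys ?n)"
    have "Poly_Mapping.keys (?m + ?n) \<subseteq> ?A"
      using Poly_Mapping.keys_add[of ?m ?n] by simp
    then have "(\<Prod>x \<in> Poly_Mapping.keys (?m + ?n). x ^ Poly_Mapping.lookup (?m + ?n) x) =
        (\<Prod>x \<in> ?A. x ^ Poly_Mapping.lookup (?m + ?n) x)"
      by (intro superset) auto
    also have "\<dots> = (\<Prod>x \<in> ?A. x ^ Poly_Mapping.lookup ?m x) * (\<Prod>x \<in> ?A. x ^ Poly_Mapping.lookup ?n x)"
      by (simp only: lookup_add power_add prod.distrib)
    also have "(\<Prod>x \<in> ?A. x ^ Poly_Mapping.lookup ?m x) = (\<Prod>x \<in> Poly_Mapping.keys ?m. x ^ Poly_Mapping.lookup ?m x)"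
      by (rule superset[symmetric]) auto
    also have "(\<Prod>x \<in> ?A. x ^ Poly_Mapping.lookup ?n x) = (\<Prod>x \<in> Poly_Mapping.keys ?n. x ^ Poly_Mapping.lookup ?n x)"
      by (rule superset[symmetric]) auto
    finally show ?case
      using Cons
      by (simp add: mon_def)
  qed (simp add: mon_def)
  \<comment> \<open>Exponents are natural numbers and cannot cancel, so only the empty word gives
    the constant monomial.\<close>
  have mon_0: "mon ws = 0 \<longleftrightarrow> ws = []" for ws
  proof (cases ws)
    case (Cons s vs)
    then have "Poly_Mapping.lookup (mon ws) (u s) \<noteq> 0"
      by (simp add: mon_def lookup_add)
    with Cons show ?thesis by auto
  qed (simp add: mon_def)
  let ?G = "generate W J"
  let ?mon = "\<lambda>w. mon (some_reduced_word w)"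
  have G: "?G \<subseteq> carrier W" "finite ?G" "\<one> \<in> ?G"
    using assms S_subset finite_carrier generate_incl[of J] by (auto intro: generate.one finite_subset)
  define p where "p = (\<Sum>w \<in> ?G. Poly_Mapping.single (?mon w) (1::complex))"
  have "(\<Sum>m \<in> Poly_Mapping.keys p. ?F m (Poly_Mapping.lookup p m)) = (\<Sum>w \<in> ?G. ?F (?mon w) 1)"
    unfolding p_def by (subst sum_keys_sum)
      (simp_all add: embedding_zero embedding_add distrib_right)
  also have "\<dots> = 0"
    using zero by (simp add: prod_mon embedding_one poincare_def uw_def)
  finally have eval: "(\<Sum>m \<in> Poly_Mapping.keys p. ?F m (Poly_Mapping.lookup p m)) = 0" .
  have keys_mon: "Poly_Mapping.keys (mon ws) \<subseteq> u ` S" if "ws \<in> lists S" for ws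
    using that
  proof (induction ws)
    case (Cons s ws)
    then show ?case
      using Poly_Mapping.keys_add[of "Poly_Mapping.single (u s) 1" "mon ws"] by (auto simp: mon_def)
  qed (simp add: mon_def)
  have "Poly_Mapping.keys p \<subseteq> ?mon ` ?G"
    unfolding p_def using Poly_Mapping.keys_sum[of "\<lambda>w. Poly_Mapping.single (?mon w) (1::complex)" ?G]
    by auto
  moreover have "some_reduced_word w \<in> lists S" if "w \<in> ?G" for w
    using that G(1) reduced_some_reduced_word[of w] by (auto simp: reduced_word_def)
  ultimately have "\<forall>m \<in> Poly_Mapping.keys p. Poly_Mapping.keys m \<subseteq> u ` S"
    using keys_mon by blast
  with eval have "p = 0"
    using u_independent unfolding algebraically_independent_def by blast
  moreover have "Poly_Mapping.lookup p 0 = (\<Sum>w \<in> ?G. if w = \<one> then 1 else 0)"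
    unfolding p_def lookup_sum
  proof (rule sum.cong)
    fix w assume "w \<in> ?G"
    then have "some_reduced_word w = [] \<longleftrightarrow> w = \<one>"
      using G reduced_some_reduced_word[of w] by (auto simp: reduced_word_def)
    then show "Poly_Mapping.lookup (Poly_Mapping.single (?mon w) (1::complex)) 0 = (if w = \<one> then 1 else 0)"
      using mon_0 by (auto simp: lookup_single when_def)
  qed simp
  ultimately show False
    using G by simp
qed


text \<open>A function stands for the formal combination \<open>\<Sum>\<^sub>w f(w) T\<^sub>w\<close>; these are the left and right
  multiplications by a generator. Both are only meaningful on \<open>carrier W\<close>.\<close>

definition left_op :: "'w \<Rightarrow> ('w \<Rightarrow> 'k) \<Rightarrow> 'w \<Rightarrow> 'k" where
  "left_op s f w = (if len (s \<otimes> w) < len w then f (s \<otimes> w) + (u s - 1) * f w else u s * f (s \<otimes> w))"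

definition right_op :: "'w \<Rightarrow> ('w \<Rightarrow> 'k) \<Rightarrow> 'w \<Rightarrow> 'k" where
  "right_op t f w = (if len (w \<otimes> t) < len w then f (w \<otimes> t) + (u t - 1) * f w else u t * f (w \<otimes> t))"

definition word_op :: "'w list \<Rightarrow> ('w \<Rightarrow> 'k) \<Rightarrow> 'w \<Rightarrow> 'k" where
  "word_op ws = foldr left_op ws"

definition delta :: "'w \<Rightarrow> 'w \<Rightarrow> 'k" where
  "delta x w = (if w = x then 1 else 0)"

text \<open>Functions are compared on \<open>carrier W\<close> only, since outside it laws such as
  \<open>s \<otimes> (s \<otimes> w) = w\<close> may fail.\<close>

definition agree :: "('w \<Rightarrow> 'k) \<Rightarrow> ('w \<Rightarrow> 'k) \<Rightarrow> bool" where
  "agree f g \<longleftrightarrow> (\<forall>w \<in> carrier W. f w = g w)"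

lemma agree_trans: "agree f g \<Longrightarrow> agree g h \<Longrightarrow> agree f h"
  by (simp add: agree_def)

lemma agree_sym: "agree f g \<Longrightarrow> agree g f"
  by (simp add: agree_def)

lemma left_op_agree: "s \<in> S \<Longrightarrow> agree f g \<Longrightarrow> agree (left_op s f) (left_op s g)"
  by (simp add: agree_def left_op_def)

lemma right_op_agree: "s \<in> S \<Longrightarrow> agree f g \<Longrightarrow> agree (right_op s f) (right_op s g)"
  by (simp add: agree_def right_op_def)

lemma word_op_Nil [simp]: "word_op [] f = f"
  by (simp add: word_op_def)

lemma word_op_Cons [simp]: "word_op (s # ws) f = left_op s (word_op ws f)"
  by (simp add: word_op_def)

lemma word_op_append: "word_op (xs @ ys) f = word_op xs (word_op ys f)"
  by (induction xs) simp_all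

lemma word_op_agree: "ws \<in> lists S \<Longrightarrow> agree f g \<Longrightarrow> agree (word_op ws f) (word_op ws g)"
  by (induction ws) (auto intro: left_op_agree)

lemma left_op_linear: "left_op s (\<lambda>w. a * f w + b * g w) = (\<lambda>w. a * left_op s f w + b * left_op s g w)"
  by (simp add: left_op_def algebra_simps fun_eq_iff)

lemma word_op_linear: "word_op ws (\<lambda>w. a * f w + b * g w) = (\<lambda>w. a * word_op ws f w + b * word_op ws g w)"
  by (induction ws) (simp_all add: left_op_linear)

lemma word_op_sum: "word_op ws (\<lambda>w. \<Sum>x\<in>A. c x * f x w) = (\<lambda>w. \<Sum>x\<in>A. c x * word_op ws (f x) w)"
proof (induction A rule: infinite_finite_induct)
  case (insert x A)
  have "word_op ws (\<lambda>w. \<Sum>x\<in>insert x A. c x * f x w)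
      = word_op ws (\<lambda>w. c x * f x w + 1 * (\<Sum>x\<in>A. c x * f x w))"
    by (simp add: insert.hyps)
  also have "\<dots> = (\<lambda>w. c x * word_op ws (f x) w + 1 * word_op ws (\<lambda>w. \<Sum>x\<in>A. c x * f x w) w)"
    using word_op_linear[of ws "c x" "f x" 1 "\<lambda>w. \<Sum>x\<in>A. c x * f x w"] .
  also have "\<dots> = (\<lambda>w. \<Sum>x\<in>insert x A. c x * word_op ws (f x) w)"
    unfolding insert.IH by (simp add: insert.hyps)
  finally show ?case .
next
  case empty
  \<comment> \<open>The zero function is viewed as a combination with coefficients 0, whatever the
    two functions.\<close>
  show ?case using word_op_linear[of ws 0 undefined 0 undefined] by simp
next
  case (infinite A)
  then show ?case using word_op_linear[of ws 0 undefined 0 undefined] by simp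
qed

lemma left_op_quadratic:
  assumes "s \<in> S"
  shows "agree (left_op s (left_op s f)) (\<lambda>w. (u s - 1) * left_op s f w + u s * f w)"
  unfolding agree_def
proof
  fix w assume w: "w \<in> carrier W"
  show "left_op s (left_op s f) w = (u s - 1) * left_op s f w + u s * f w"
  proof (cases "len (s \<otimes> w) < len w")
    case True
    then show ?thesis using assms w by (simp add: left_op_def)
  next
    case False
    then have "len w < len (s \<otimes> w)" using assms w len_S_mult[of s w] by linarith
    then show ?thesis using assms w by (simp add: left_op_def algebra_simps)
  qed
qed

lemma left_op_delta:
  assumes "s \<in> S" "x \<in> carrier W" "len x < len (s \<otimes> x)"
  shows "agree (left_op s (delta x)) (delta (s \<otimes> x))"
  unfolding agree_def
proof
  fix w assume w: "w \<in> carrier W"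
  have "s \<otimes> w = x \<longleftrightarrow> w = s \<otimes> x"
    using assms w by auto
  then show "left_op s (delta x) w = delta (s \<otimes> x) w"
    using assms w by (auto simp: left_op_def delta_def)
qed

lemma right_op_delta:
  assumes "s \<in> S" "x \<in> carrier W" "len x < len (x \<otimes> s)"
  shows "agree (right_op s (delta x)) (delta (x \<otimes> s))"
  unfolding agree_def
proof
  fix w assume w: "w \<in> carrier W"
  have "w \<otimes> s = x \<longleftrightarrow> w = x \<otimes> s"
    using assms w by auto
  then show "right_op s (delta x) w = delta (x \<otimes> s) w"
    using assms w by (auto simp: right_op_def delta_def)
qed

text \<open>This is associativity \<open>T\<^sub>s (h T\<^sub>t) = (T\<^sub>s h) T\<^sub>t\<close>.
  If opposite sides of the square w, sw, wt, swt change the length in the same direction, both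
  expansions coincide. In the remaining case \<open>square_eq\<close> collapses the square to
  \<open>s \<otimes> w = w \<otimes> t\<close>, and conjugacy gives
  \<open>u s = u t\<close>.\<close>

lemma left_right_op_commute:
  assumes "s \<in> S" "t \<in> S"
  shows "agree (left_op s (right_op t f)) (right_op t (left_op s f))"
  unfolding agree_def
proof
  fix w assume w: "w \<in> carrier W"
  have assoc: "s \<otimes> (w \<otimes> t) = s \<otimes> w \<otimes> t"
    using assms w by (simp add: m_assoc)
  note len = len_S_mult[of s w] len_mult_S[of t w] len_S_mult[of s "w \<otimes> t"] len_mult_S[of t "s \<otimes> w"]
  show "left_op s (right_op t f) w = right_op t (left_op s f) w"
  proof (cases "len (s \<otimes> w \<otimes> t) = len w \<and> len (s \<otimes> w) = len (w \<otimes> t)")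
    case True
    have eq: "s \<otimes> w = w \<otimes> t"
    proof (cases "len w < len (s \<otimes> w)")
      case True
      with \<open>_ \<and> _\<close> assms w show ?thesis
        by (intro square_eq) auto
    next
      case False
      \<comment> \<open>Here \<open>s \<otimes> w\<close> is at the bottom of the square, so
        \<open>square_eq\<close> is applied to it instead of w.\<close>
      then have "s \<otimes> (s \<otimes> w) = s \<otimes> w \<otimes> t"
        using \<open>_ \<and> _\<close> assms w len by (intro square_eq) (auto simp: assoc)
      then have "w \<otimes> t = s \<otimes> w \<otimes> t \<otimes> t"
        using assms w by simp
      then show ?thesis using assms w by simp
    qed
    then have "t = inv w \<otimes> s \<otimes> inv (inv w)"
      using assms w by (metis inv_closed inv_inv inv_solve_left m_assoc m_closed S_closed)
    then have "u s = u t"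
      using assms w u_eq_iff conjugate_def by (metis inv_closed)
    with eq show ?thesis
      using assms w len True by (auto simp: left_op_def right_op_def assoc algebra_simps)
  next
    case False
    then have "len (s \<otimes> w \<otimes> t) < len (w \<otimes> t) \<longleftrightarrow> len (s \<otimes> w) < len w"
      "len (s \<otimes> w \<otimes> t) < len (s \<otimes> w) \<longleftrightarrow> len (w \<otimes> t) < len w"
      using assms w len by (auto simp: assoc)
    then show ?thesis
      by (simp add: left_op_def right_op_def assoc algebra_simps)
  qed
qed

lemma word_right_op_commute:
  assumes "ws \<in> lists S" "t \<in> S"
  shows "agree (word_op ws (right_op t f)) (right_op t (word_op ws f))"
  using assms(1)
proof (induction ws)
  case Nil
  then show ?case by (simp add: agree_def)
next
  case (Cons s ws)
  then have "agree (left_op s (word_op ws (right_op t f))) (left_op s (right_op t (word_op ws f)))"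
    by (auto intro: left_op_agree)
  with left_right_op_commute[of s t "word_op ws f"] Cons assms show ?case
    by (auto intro: agree_trans)
qed

lemma word_op_reduced_delta: "reduced_word w ws \<Longrightarrow> agree (word_op ws (delta \<one>)) (delta w)"
proof (induction ws arbitrary: w)
  case Nil
  then show ?case by (simp add: agree_def reduced_word_def)
next
  case (Cons s ws)
  let ?v = "word_value W ws"
  have s: "s \<in> S" "ws \<in> lists S" "w = s \<otimes> ?v" "len w = Suc (length ws)"
    using Cons.prems by (auto simp: reduced_word_def)
  then have v: "reduced_word ?v ws" "len ?v < len (s \<otimes> ?v)"
    using len_le[of ws] len_S_mult[of s ?v] by (auto simp: reduced_word_def)
  have "agree (left_op s (word_op ws (delta \<one>))) (left_op s (delta ?v))"
    using s v Cons.IH by (intro left_op_agree)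
  with left_op_delta[of s ?v] s v show ?case
    by (auto intro: agree_trans)
qed

text \<open>Since the left operators commute with the right ones, they are determined by their values
  at the identity. This gives the braid relations.\<close>

lemma word_op_reduced_eq:
  assumes "reduced_word w ws" "reduced_word w vs"
  shows "agree (word_op ws f) (word_op vs f)"
proof -
  have lists: "ws \<in> lists S" "vs \<in> lists S"
    using assms by (auto simp: reduced_word_def)
  have delta: "agree (word_op ws (delta x)) (word_op vs (delta x))" if "x \<in> carrier W" for x
    using that
  proof (induction "len x" arbitrary: x)
    case 0
    then have "x = \<one>" by (simp add: len_eq_0)
    then show ?case
      using word_op_reduced_delta assms by (blast intro: agree_trans agree_sym)
  next
    case (Suc n)
    then obtain y t where y: "y \<in> carrier W" "t \<in> S" "x = y \<otimes> t" and n: "len y = n" "len y < len (y \<otimes> t)"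
      using right_descent_exists[of x n] by (metis lessI)
    \<comment> \<open>Since t lengthens y, \<open>delta x\<close> agrees with
      \<open>right_op t (delta y)\<close>, and the right operator can be pulled out in front of the
      word operator.\<close>
    have x: "agree (word_op zs (delta x)) (right_op t (word_op zs (delta y)))" if "zs \<in> lists S" for zs
    proof (rule agree_trans)
      show "agree (word_op zs (delta x)) (word_op zs (right_op t (delta y)))"
        using right_op_delta[of t y] y n that by (intro word_op_agree) (auto intro: agree_sym)
      show "agree (word_op zs (right_op t (delta y))) (right_op t (word_op zs (delta y)))"
        using that y by (intro word_right_op_commute)
    qed
    have "agree (right_op t (word_op ws (delta y))) (right_op t (word_op vs (delta y)))"
      using Suc.hyps(1)[of y] y n by (intro right_op_agree) auto
    then show ?case
      using x[OF lists(1)] x[OF lists(2)] by (blast intro: agree_trans agree_sym)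
  qed
  have "f x * delta x w = (if w = x then f x else 0)" for x w
    by (simp add: delta_def)
  then have "agree f (\<lambda>w. \<Sum>x \<in> carrier W. f x * delta x w)"
    using finite_carrier by (simp add: agree_def)
  then have f: "agree (word_op zs f) (\<lambda>w. \<Sum>x \<in> carrier W. f x * word_op zs (delta x) w)"
    if "zs \<in> lists S" for zs
    using word_op_agree[OF that] word_op_sum[of zs f delta] by metis
  show ?thesis
    using f[OF lists(1)] f[OF lists(2)] delta by (simp add: agree_def)
qed

lemma word_op_braid:
  assumes "s \<in> S" "t \<in> S"
  shows "agree (word_op (alternating_word (ord (s \<otimes> t)) s t) f) (word_op (alternating_word (ord (s \<otimes> t)) t s) f)"
  using assms len_alternating_word[of s t "ord (s \<otimes> t)"] word_value_alternating_eq[of s t]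
  by (intro word_op_reduced_eq) (auto simp: reduced_word_def alternating_word_in_lists)

text \<open>The free algebra acts on functions through \<open>word_op\<close>; this action factors
  through the quotient by the relations. It serves to detect that a combination of words is not in
  \<open>hecke_ideal\<close>.\<close>

lemma hecke_ideal_acts_zero:
  assumes "p \<in> hecke_ideal" "w \<in> carrier W"
  shows "(\<Sum>ws \<in> Poly_Mapping.keys p. Poly_Mapping.lookup p ws * word_op ws f w) = 0"
  using assms(1)
proof induction
  case zero
  then show ?case by simp
next
  case (quadratic p s x y c)
  let ?g = "word_op y f"
  have "agree (word_op x (left_op s (left_op s ?g))) (word_op x (\<lambda>w. (u s - 1) * left_op s ?g w + u s * ?g w))"
    using quadratic by (intro word_op_agree left_op_quadratic)
  then have "word_op (x @ [s, s] @ y) f w = (u s - 1) * word_op (x @ [s] @ y) f w + u s * word_op (x @ y) f w"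
    using assms(2) by (simp add: word_op_append agree_def word_op_linear)
  with quadratic.IH show ?case
    by (simp add: sum_keys_add[of "\<lambda>ws a. a * word_op ws f w"] sum_keys_diff[of "\<lambda>ws a. a * word_op ws f w"]
        sum_keys_single[of "\<lambda>ws a. a * word_op ws f w"] distrib_right del: keys_single lookup_single)
      (simp add: algebra_simps)
next
  case (braid p s t x y c)
  let ?a = "alternating_word (ord (s \<otimes> t)) s t" and ?b = "alternating_word (ord (s \<otimes> t)) t s"
  have "agree (word_op x (word_op ?a (word_op y f))) (word_op x (word_op ?b (word_op y f)))"
    using braid by (intro word_op_agree word_op_braid)
  then have "word_op (x @ ?a @ y) f w = word_op (x @ ?b @ y) f w"
    using assms(2) by (simp add: word_op_append agree_def)
  with braid.IH show ?case
    by (simp add: sum_keys_add[of "\<lambda>ws a. a * word_op ws f w"] sum_keys_diff[of "\<lambda>ws a. a * word_op ws f w"]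
        sum_keys_single[of "\<lambda>ws a. a * word_op ws f w"] distrib_right del: keys_single lookup_single)
qed

end

section \<open>Idempotents and simple right ideals\<close>

context k_algebra
begin

section \<open>Linear forms and traces\<close>

definition functional :: "('h \<Rightarrow> 'k) \<Rightarrow> bool" where
  "functional \<mu> \<longleftrightarrow> (\<forall>x y. \<mu> (x + y) = \<mu> x + \<mu> y) \<and> (\<forall>c x. \<mu> (c *s x) = c * \<mu> x)"

lemma functional_add: "functional \<mu> \<Longrightarrow> \<mu> (x + y) = \<mu> x + \<mu> y"
  by (simp add: functional_def)

lemma functional_scale: "functional \<mu> \<Longrightarrow> \<mu> (c *s x) = c * \<mu> x"
  by (simp add: functional_def)

lemma functional_zero: "functional \<mu> \<Longrightarrow> \<mu> 0 = 0"
  using functional_scale[of \<mu> 0 0] by simp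

lemma functional_sum: "functional \<mu> \<Longrightarrow> \<mu> (\<Sum>i\<in>A. c i *s x i) = (\<Sum>i\<in>A. c i * \<mu> (x i))"
  by (induction A rule: infinite_finite_induct)
    (simp_all add: functional_zero functional_add functional_scale)

lemma functional_mult_left: "functional \<mu> \<Longrightarrow> functional (\<lambda>x. \<mu> (h * x))"
  by (simp add: functional_def distrib_left scale_mult_right)

lemma functional_mult_right: "functional \<mu> \<Longrightarrow> functional (\<lambda>x. \<mu> (x * h))"
  by (simp add: functional_def distrib_right scale_mult_left)

lemma linear_map_UNIV_sum:
  assumes "linear_map UNIV UNIV g"
  shows "g (\<Sum>i\<in>A. c i *s x i) = (\<Sum>i\<in>A. c i *s g (x i))"
proof -
  have add: "g (x + y) = g x + g y" and scale: "g (c *s x) = c *s g x" for x y c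
    using assms by (auto simp: linear_map_def)
  have "g 0 = 0"
    using scale[of 0 0] by simp
  then show ?thesis
    by (induction A rule: infinite_finite_induct) (simp_all add: add scale)
qed

text \<open>The basis chosen inside \<open>trace_on\<close> depends only on V, so one basis serves
  all endomorphisms; it is finite because V is finitely spanned.\<close>

lemma trace_on_basis:
  assumes "right_module V act"
  obtains B where "finite B" "independent B" "span B = V"
    "\<And>\<phi>. trace_on V \<phi> = (\<Sum>b\<in>B. representation B (\<phi> b) b)"
proof -
  obtain F where F: "finite F" "V = span F"
    using assms by (auto simp: right_module_def)
  have "\<exists>B. independent B \<and> span B = V"
    using basis_exists[of V] F by (metis span_span span_mono subset_antisym)
  then have B: "independent (SOME B. independent B \<and> span B = V)"
    "span (SOME B. independent B \<and> span B = V) = V"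
    by (metis (mono_tags, lifting) someI_ex)+
  moreover from this have "finite (SOME B. independent B \<and> span B = V)"
    using independent_span_bound[OF F(1), of "SOME B. independent B \<and> span B = V"] F(2) span_superset
    by blast
  ultimately show thesis
    by (intro that) (auto simp: trace_on_def Let_def)
qed

lemma trace_on_rank_one:
  assumes "right_module V act" "functional \<mu>" "a \<in> V" "\<And>v. v \<in> V \<Longrightarrow> \<phi> v = \<mu> v *s a"
  shows "trace_on V \<phi> = \<mu> a"
proof -
  obtain B where B: "finite B" "independent B" "span B = V"
    "\<And>\<phi>. trace_on V \<phi> = (\<Sum>b\<in>B. representation B (\<phi> b) b)"
    using trace_on_basis[OF assms(1)] by blast
  have "trace_on V \<phi> = (\<Sum>b\<in>B. representation B a b * \<mu> b)"
    unfolding B(4)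
  proof (rule sum.cong)
    fix b assume "b \<in> B"
    then have "b \<in> V" using B span_superset by blast
    then show "representation B (\<phi> b) b = representation B a b * \<mu> b"
      using assms(3,4) B by (simp add: representation_scale)
  qed simp
  also have "\<dots> = \<mu> (\<Sum>b\<in>B. representation B a b *s b)"
    by (rule functional_sum[OF assms(2), symmetric])
  also have "(\<Sum>b\<in>B. representation B a b *s b) = a"
    using B assms(3) by (intro sum_representation_eq) auto
  finally show ?thesis .
qed

text \<open>Schur's lemma: a map that is not zero has kernel 0 and image \<open>V'\<close>, hence
  would be an isomorphism.\<close>

lemma simple_module_map_zero:
  assumes V: "simple_module V (*)" and V': "simple_module V' (*)"
    and "\<not> isomorphic V (*) V' (*)" and \<phi>: "module_map V (*) V' (*) \<phi>" and "v \<in> V"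
  shows "\<phi> v = 0"
proof (rule ccontr)
  assume nz: "\<phi> v \<noteq> 0"
  have add: "\<phi> (x + y) = \<phi> x + \<phi> y" and scale: "\<phi> (c *s x) = c *s \<phi> x" and mult: "\<phi> (x * h) = \<phi> x * h"
    and closed: "\<phi> x \<in> V'" if "x \<in> V" "y \<in> V" for x y c h
    using \<phi> that by (auto simp: module_map_def linear_map_def)
  have V_closed: "x + y \<in> V" "c *s x \<in> V" "x * h \<in> V" "0 \<in> V" if "x \<in> V" "y \<in> V" for x y c h
    using V that span_add[of x _ y] span_scale[of x] span_zero
    by (auto simp: simple_module_def right_module_def)
  have \<phi>0: "\<phi> 0 = 0"
    using scale[OF \<open>v \<in> V\<close> \<open>v \<in> V\<close>, of 0] by simp
  have "submodule {x \<in> V. \<phi> x = 0} V (*)"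
    using V_closed add scale mult \<open>v \<in> V\<close> \<phi>0 by (auto simp: submodule_def subspace_def)
  then have "{x \<in> V. \<phi> x = 0} = {0} \<or> {x \<in> V. \<phi> x = 0} = V"
    using V by (simp add: simple_module_def)
  with nz \<open>v \<in> V\<close> have ker: "x = 0" if "x \<in> V" "\<phi> x = 0" for x
    using that by blast
  have "inj_on \<phi> V"
  proof (rule inj_onI)
    fix x y assume xy: "x \<in> V" "y \<in> V" "\<phi> x = \<phi> y"
    have "\<phi> (x + (-1) *s y) = \<phi> x + (-1) *s \<phi> y"
      using add[of x "(-1) *s y"] scale[of y y "-1"] V_closed(2)[of y y "-1"] xy by (simp only:)
    then have "\<phi> (x + (-1) *s y) = 0"
      using xy(3) by simp
    then have "x + (-1) *s y = 0"
      using ker V_closed xy by blast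
    then show "x = y" by simp
  qed
  moreover have "submodule (\<phi> ` V) V' (*)"
    unfolding submodule_def subspace_def
  proof (intro conjI ballI allI)
    show "\<phi> ` V \<subseteq> V'" using closed by auto
    show "0 \<in> \<phi> ` V" using \<phi>0 V_closed \<open>v \<in> V\<close> by force
    fix x assume "x \<in> \<phi> ` V"
    then obtain a where a: "a \<in> V" "x = \<phi> a" by blast
    show "c *s x \<in> \<phi> ` V" for c
      using a V_closed(2)[of a a c] scale[of a a c] by force
    show "x * h \<in> \<phi> ` V" for h
      using a V_closed(3)[of a a h] mult[of a a h] by force
    fix y assume "y \<in> \<phi> ` V"
    then obtain b where "b \<in> V" "y = \<phi> b" by blast
    then show "x + y \<in> \<phi> ` V"
      using a V_closed(1)[of a b] add[of a b] by force
  qed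
  then have "\<phi> ` V = {0} \<or> \<phi> ` V = V'"
    using V' by (simp add: simple_module_def)
  then have "\<phi> ` V = V'"
    using nz \<open>v \<in> V\<close> by blast
  ultimately have "bij_betw \<phi> V V'"
    by (simp add: bij_betw_def)
  with \<phi> assms(3) show False
    by (auto simp: isomorphic_def)
qed

lemma isomorphic_refl: "isomorphic V act V act"
  unfolding isomorphic_def module_map_def linear_map_def
  by (intro exI[of _ id]) auto

text \<open>The test module in \<open>multiplicity_free\<close> is taken to be the summand
  \<open>V j\<close> itself, which would be counted at both i and j.\<close>

lemma multiplicity_free_not_isomorphic:
  assumes "multiplicity_free M act" "simple_decomposition n V M act"
    and "i \<in> {1..n}" "j \<in> {1..n}" "i \<noteq> j"
  shows "\<not> isomorphic (V i) act (V j) act"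
proof
  assume "isomorphic (V i) act (V j) act"
  then have "{i, j} \<subseteq> {k \<in> {1..n}. isomorphic (V k) act (V j) act}"
    using assms isomorphic_refl by auto
  then have "card {i, j} \<le> card {k \<in> {1..n}. isomorphic (V k) act (V j) act}"
    by (intro card_mono) auto
  moreover have "simple_module (V j) act"
    using assms by (simp add: simple_decomposition_def)
  ultimately show False
    using assms unfolding multiplicity_free_def by fastforce
qed

lemma simple_decomposition_unique:
  assumes "simple_decomposition n V M (*)"
    and "\<And>i. i \<in> {1..n} \<Longrightarrow> v i \<in> V i" "\<And>i. i \<in> {1..n} \<Longrightarrow> w i \<in> V i"
    and "(\<Sum>i\<in>{1..n}. v i) = (\<Sum>i\<in>{1..n}. w i)" "i \<in> {1..n}"
  shows "v i = w i"
proof -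
  have "\<forall>i\<in>{1..n}. v i - w i \<in> V i"
    using assms subspace_diff unfolding simple_decomposition_def submodule_def by blast
  moreover have "(\<Sum>i\<in>{1..n}. v i - w i) = 0"
    using assms(4) by (simp add: sum_subtractf)
  ultimately have "\<forall>i\<in>{1..n}. v i - w i = 0"
    using assms(1) unfolding simple_decomposition_def by (elim conjE allE[of _ "\<lambda>i. v i - w i"]) blast
  with assms(5) show ?thesis by auto
qed

text \<open>Left multiplication by e is the identity on \<open>e H\<close>. With e written as the
  sum of its components, \<open>v = e * v\<close> for v in \<open>V i\<close> becomes a second
  decomposition of v, and uniqueness gives \<open>d j * v\<close>. Comparing \<open>e * e\<close>
  with e yields \<open>d i * e = d i\<close>.\<close>

lemma idempotent_components:
  assumes dec: "simple_decomposition n V {e * h | h. True} (*)" and idem: "e * e = e"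
  obtains d where "e = (\<Sum>i\<in>{1..n}. d i)"
    and "\<And>i. i \<in> {1..n} \<Longrightarrow> d i \<in> V i" and "\<And>i. i \<in> {1..n} \<Longrightarrow> d i \<noteq> 0"
    and "\<And>i. i \<in> {1..n} \<Longrightarrow> e * d i = d i" and "\<And>i. i \<in> {1..n} \<Longrightarrow> d i * e = d i"
    and "\<And>i j. i \<in> {1..n} \<Longrightarrow> j \<in> {1..n} \<Longrightarrow> d i * d j = (if i = j then d i else 0)"
    and "\<And>i. i \<in> {1..n} \<Longrightarrow> V i = {v. d i * v = v}"
proof -
  let ?M = "{e * h | h. True}"
  have V: "V i \<subseteq> ?M" "subspace (V i)" "\<And>v h. v \<in> V i \<Longrightarrow> v * h \<in> V i" "V i \<noteq> {0}"
    if "i \<in> {1..n}" for i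
  proof -
    have "submodule (V i) ?M (*)" "simple_module (V i) (*)"
      using dec that unfolding simple_decomposition_def by blast+
    then show "V i \<subseteq> ?M" "subspace (V i)" "\<And>v h. v \<in> V i \<Longrightarrow> v * h \<in> V i" "V i \<noteq> {0}"
      by (simp_all add: submodule_def simple_module_def)
  qed
  have eV: "e * v = v" if "v \<in> V i" "i \<in> {1..n}" for v i
    using V(1)[OF that(2)] that(1) idem by (auto simp flip: mult.assoc)
  have "e \<in> ?M" using mult_1_right[of e] by (metis (mono_tags, lifting) mem_Collect_eq)
  also have "?M = {\<Sum>i\<in>{1..n}. v i | v. \<forall>i \<in> {1..n}. v i \<in> V i}"
    using dec by (simp add: simple_decomposition_def)
  finally obtain d where d: "e = (\<Sum>i\<in>{1..n}. d i)" "\<And>i. i \<in> {1..n} \<Longrightarrow> d i \<in> V i"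
    by blast
  have dv: "d j * v = (if j = i then v else 0)" if "v \<in> V i" "i \<in> {1..n}" "j \<in> {1..n}" for v i j
  proof -
    have "(\<Sum>j\<in>{1..n}. d j * v) = (\<Sum>j\<in>{1..n}. if j = i then v else 0)"
      using eV[OF that(1,2)] that(2) by (simp add: d(1) sum_distrib_right)
    then show ?thesis
      using that d V by (intro simple_decomposition_unique[OF dec, of "\<lambda>j. d j * v" "\<lambda>j. if j = i then v else 0"])
        (auto simp: subspace_0)
  qed
  have de: "d i * e = d i" if "i \<in> {1..n}" for i
  proof -
    have "(\<Sum>i\<in>{1..n}. d i * e) = (\<Sum>i\<in>{1..n}. d i)"
      using idem by (simp add: d(1) flip: sum_distrib_right)
    then show ?thesis
      using that d V by (intro simple_decomposition_unique[OF dec, of "\<lambda>i. d i * e" d]) auto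
  qed
  show thesis
  proof (rule that[of d])
    show "V i = {v. d i * v = v}" if "i \<in> {1..n}" for i
      using dv that V(3)[OF that d(2)[OF that]] by (auto, metis)
    show "d i \<noteq> 0" if "i \<in> {1..n}" for i
    proof
      assume "d i = 0"
      then have "v = 0" if "v \<in> V i" for v
        using dv[OF that \<open>i \<in> _\<close> \<open>i \<in> _\<close>] by simp
      then show False
        using V(2,4)[OF that] subspace_0 by blast
    qed
    show "d i * d j = (if i = j then d i else 0)" if "i \<in> {1..n}" "j \<in> {1..n}" for i j
      using dv[OF d(2)[OF that(2)] that(2,1)] by auto
  qed (use d de eV in auto)
qed

end


section \<open>Schur elements of symmetric algebras\<close>

text \<open>\<open>b\<close> and \<open>b'\<close> play the part of dual bases for the symmetric
  form; duality is encoded by the two expansion formulas, the shape in which it enters the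
  computations.\<close>

locale symmetric_algebra = k_algebra scale
  for scale :: "'k::field \<Rightarrow> 'h::ring_1 \<Rightarrow> 'h" (infixr \<open>*s\<close> 75) +
  fixes \<tau> :: "'h \<Rightarrow> 'k" and I :: "'i set" and b b' :: "'i \<Rightarrow> 'h"
  assumes functional_trace: "functional \<tau>"
    and trace_commute: "\<tau> (x * y) = \<tau> (y * x)"
    and expand: "(\<Sum>i\<in>I. \<tau> (b' i * h) *s b i) = h"
    and expand_dual: "(\<Sum>i\<in>I. \<tau> (b i * h) *s b' i) = h"
begin

lemma scale_sum_mult: "(\<Sum>i\<in>A. c i *s x i) * h = (\<Sum>i\<in>A. c i *s (x i * h))"
  by (simp add: sum_distrib_right scale_mult_left)

lemma mult_scale_sum: "h * (\<Sum>i\<in>A. c i *s x i) = (\<Sum>i\<in>A. c i *s (h * x i))"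
  by (simp add: sum_distrib_left scale_mult_right)

text \<open>The element \<open>\<Sum>\<^sub>i b\<^sub>i \<otimes> b'\<^sub>i\<close> of the tensor square, probed by a linear map \<open>g\<close> on the
  left factor.\<close>

lemma casimir_left:
  assumes "linear_map UNIV UNIV g"
  shows "(\<Sum>i\<in>I. g (h * b i) * b' i) = (\<Sum>i\<in>I. g (b i) * (b' i * h))"
proof -
  have "(\<Sum>i\<in>I. g (h * b i) * b' i) = (\<Sum>i\<in>I. \<Sum>j\<in>I. \<tau> (b' j * (h * b i)) *s (g (b j) * b' i))"
  proof (rule sum.cong)
    fix i
    have "g (h * b i) = (\<Sum>j\<in>I. \<tau> (b' j * (h * b i)) *s g (b j))"
      using linear_map_UNIV_sum[OF assms] expand[of "h * b i"] by metis
    then show "g (h * b i) * b' i = (\<Sum>j\<in>I. \<tau> (b' j * (h * b i)) *s (g (b j) * b' i))"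
      by (simp add: scale_sum_mult)
  qed simp
  \<comment> \<open>After exchanging the sums, symmetry of \<tau> turns the coefficients into those
    of \<open>b' j * h\<close> in the family \<open>b'\<close>.\<close>
  also have "\<dots> = (\<Sum>j\<in>I. \<Sum>i\<in>I. \<tau> (b i * (b' j * h)) *s (g (b j) * b' i))"
    by (subst sum.swap) (simp add: trace_commute[of "b _" "b' _ * h"] mult.assoc)
  also have "\<dots> = (\<Sum>j\<in>I. g (b j) * (b' j * h))"
    by (simp add: expand_dual flip: mult_scale_sum)
  finally show ?thesis .
qed

text \<open>Symmetry of \<tau> now rotates h in front of \<open>b' j\<close>: taken off the right of
  \<open>b i\<close>, it reappears on the left of \<open>b' i\<close>.\<close>

lemma casimir_right:
  assumes "linear_map UNIV UNIV g"
  shows "(\<Sum>i\<in>I. g (b i * h) * b' i) = (\<Sum>i\<in>I. g (b i) * (h * b' i))"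
proof -
  have "(\<Sum>i\<in>I. g (b i * h) * b' i) = (\<Sum>i\<in>I. \<Sum>j\<in>I. \<tau> (b' j * (b i * h)) *s (g (b j) * b' i))"
  proof (rule sum.cong)
    fix i
    have "g (b i * h) = (\<Sum>j\<in>I. \<tau> (b' j * (b i * h)) *s g (b j))"
      using linear_map_UNIV_sum[OF assms] expand[of "b i * h"] by metis
    then show "g (b i * h) * b' i = (\<Sum>j\<in>I. \<tau> (b' j * (b i * h)) *s (g (b j) * b' i))"
      by (simp add: scale_sum_mult)
  qed simp
  also have "\<dots> = (\<Sum>j\<in>I. \<Sum>i\<in>I. \<tau> (b i * (h * b' j)) *s (g (b j) * b' i))"
    by (subst sum.swap) (simp add: trace_commute[of "b' _" "b _ * h"] mult.assoc)
  also have "\<dots> = (\<Sum>j\<in>I. g (b j) * (h * b' j))"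
    by (simp add: expand_dual flip: mult_scale_sum)
  finally show ?thesis .
qed

lemma linear_map_functional: "functional \<mu> \<Longrightarrow> linear_map UNIV UNIV (\<lambda>x. \<mu> x *s a)"
  by (simp add: linear_map_def functional_def scale_left_distrib)

text \<open>The element that represents f through the trace form, see
  \<open>trace_dual_element\<close>; for the Hecke algebra it is \<open>star f\<close>.\<close>

definition dual_element :: "('h \<Rightarrow> 'k) \<Rightarrow> 'h" where
  "dual_element f = (\<Sum>i\<in>I. f (b i) *s b' i)"

text \<open>h is carried from \<open>b'\<close> to \<open>b\<close> by \<open>casimir_right\<close>,
  passed through f by the trace property, and carried back by \<open>casimir_left\<close> onto the
  other side of \<open>b'\<close>.\<close>

lemma dual_element_central:
  assumes "functional f" "\<And>x y. f (x * y) = f (y * x)"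
  shows "h * dual_element f = dual_element f * h"
proof -
  \<comment> \<open>Scalars are written as multiples of 1, so that
    \<open>\<lambda>x. f x *s 1\<close> can serve as the linear map of the Casimir
    identities.\<close>
  have "h * dual_element f = (\<Sum>i\<in>I. (f (b i) *s 1) * (h * b' i))"
    by (simp add: dual_element_def mult_scale_sum scale_mult_left)
  also have "\<dots> = (\<Sum>i\<in>I. (f (b i * h) *s 1) * b' i)"
    by (rule casimir_right[OF linear_map_functional[OF assms(1)], symmetric])
  also have "\<dots> = (\<Sum>i\<in>I. (f (h * b i) *s 1) * b' i)"
    by (simp add: assms(2)[of h])
  also have "\<dots> = (\<Sum>i\<in>I. (f (b i) *s 1) * (b' i * h))"
    by (rule casimir_left[OF linear_map_functional[OF assms(1)]])
  also have "\<dots> = dual_element f * h"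
    by (simp add: dual_element_def scale_sum_mult scale_mult_left)
  finally show ?thesis .
qed

lemma trace_dual_element: "functional f \<Longrightarrow> \<tau> (dual_element f * h) = f h"
proof -
  assume f: "functional f"
  have "\<tau> (dual_element f * h) = (\<Sum>i\<in>I. f (b i) * \<tau> (b' i * h))"
    by (simp add: dual_element_def scale_sum_mult functional_sum[OF functional_trace])
  also have "\<dots> = f (\<Sum>i\<in>I. \<tau> (b' i * h) *s b i)"
    by (simp add: functional_sum[OF f] mult.commute)
  finally show ?thesis by (simp add: expand)
qed

end

text \<open>One summand \<open>V = d H\<close> in isolation; splitness enters as the statement that
  its endomorphisms are scalars.\<close>

locale split_idempotent = symmetric_algebra scale \<tau> I b b'
  for scale :: "'k::field \<Rightarrow> 'h::ring_1 \<Rightarrow> 'h" (infixr \<open>*s\<close> 75)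
    and \<tau> :: "'h \<Rightarrow> 'k" and I :: "'i set" and b b' :: "'i \<Rightarrow> 'h" +
  fixes d :: 'h and V :: "'h set"
  assumes V_eq: "V = {v. d * v = v}" and d_idem: "d * d = d" and d_nonzero: "d \<noteq> 0"
    and V_module: "right_module V (*)"
    and split: "module_map V (*) V (*) \<phi> \<Longrightarrow> \<exists>c. \<forall>v \<in> V. \<phi> v = c *s v"
begin

lemma V_iff: "v \<in> V \<longleftrightarrow> d * v = v"
  by (simp add: V_eq)

lemma d_in_V [simp]: "d \<in> V"
  by (simp add: V_eq d_idem)

lemma d_mult_in_V [simp]: "d * h \<in> V"
  by (simp add: V_eq d_idem flip: mult.assoc)

lemma V_mult [simp]: "v \<in> V \<Longrightarrow> v * h \<in> V"
  by (simp add: V_eq flip: mult.assoc)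

lemma d_scale_eq_iff: "c *s d = c' *s d \<longleftrightarrow> c = c'"
  using d_nonzero by simp

definition corner :: "'h \<Rightarrow> 'k" where
  "corner h = (THE c. d * h * d = c *s d)"

text \<open>Left multiplication by \<open>d * h * d\<close> is an endomorphism of V, hence a scalar,
  and its value at d is \<open>d * h * d\<close>. So \<open>d H d\<close> is the line of d.\<close>

lemma corner: "d * h * d = corner h *s d"
proof -
  have "module_map V (*) V (*) (\<lambda>v. d * h * d * v)"
    by (auto simp: module_map_def linear_map_def mult.assoc distrib_left scale_mult_right)
  then obtain c where "\<forall>v\<in>V. d * h * d * v = c *s v" using split by blast
  then have c: "d * h * d = c *s d"
    using d_in_V d_idem by (metis mult.assoc)
  then have "corner h = c"
    unfolding corner_def by (simp add: d_nonzero)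
  with c show ?thesis by simp
qed

lemma corner_eqI: "d * h * d = c *s d \<Longrightarrow> corner h = c"
  using corner[of h] d_scale_eq_iff by metis

lemma functional_corner: "functional corner"
  unfolding functional_def
  by (auto intro!: corner_eqI simp: distrib_left distrib_right scale_mult_left scale_mult_right
      corner scale_left_distrib)

lemma corner_d: "corner d = 1"
  by (rule corner_eqI) (simp add: d_idem)

text \<open>The rank-one map \<open>\<lambda>v. \<mu> v *s a\<close> is averaged over the dual
  bases; \<open>casimir_left\<close> moves h out to the right. The target is the fixed space of a
  variable \<open>a'\<close>, so that V itself or another summand can be inserted.\<close>

lemma averaged_module_map:
  assumes "functional \<mu>" "a' * a = a"
  shows "module_map V (*) {v. a' * v = v} (*) (\<lambda>v. \<Sum>i\<in>I. \<mu> (v * b i) *s (a * b' i))"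
proof -
  have eq: "(\<Sum>i\<in>I. \<mu> (v * h * b i) *s (a * b' i)) = (\<Sum>i\<in>I. \<mu> (v * b i) *s (a * b' i)) * h" for v h
    using casimir_left[where h = h, OF linear_map_functional[where a = a, OF functional_mult_left[where h = v, OF assms(1)]]]
    by (simp add: scale_mult_left mult.assoc scale_sum_mult)
  have "a' * (\<Sum>i\<in>I. \<mu> (v * b i) *s (a * b' i)) = (\<Sum>i\<in>I. \<mu> (v * b i) *s (a * b' i))" for v
    using assms(2) by (simp add: mult_scale_sum flip: mult.assoc)
  with eq show ?thesis
    using assms
    by (auto simp: module_map_def linear_map_def distrib_right functional_add scale_left_distrib
        sum.distrib scale_mult_left functional_scale scale_sum_right)
qed

text \<open>The constant is read off from the single rank-one map
  \<open>\<lambda>v. corner v *s d\<close>, averaged and evaluated at d; the trace of this map is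
  \<open>corner d = 1\<close>.\<close>

definition schur_const :: 'k where
  "schur_const = (THE c. (\<Sum>i\<in>I. corner (b i) *s (d * b' i)) = c *s d)"

text \<open>Moving \<open>a = d a\<close> and then \<open>d = d d\<close> across the Casimir element turns \<open>\<mu>\<close> into a multiple of
  the functional \<open>corner\<close>.\<close>

lemma averaged_rank_one:
  assumes "functional \<mu>" "v \<in> V" "a \<in> V"
  shows "(\<Sum>i\<in>I. \<mu> (v * b i) *s (a * b' i)) = (schur_const * \<mu> a) *s v"
proof -
  have scalar: "\<exists>c. \<forall>v\<in>V. (\<Sum>i\<in>I. \<nu> (v * b i) *s (a * b' i)) = c *s v" if "functional \<nu>" "a \<in> V" for \<nu> a
    using averaged_module_map[OF that(1), of d a] that(2) split V_eq by simp
  have move: "(\<Sum>i\<in>I. \<nu> (d * b i) *s (x * y * b' i)) = (\<Sum>i\<in>I. \<nu> (d * b i * y) *s (x * b' i))"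
    if "functional \<nu>" for \<nu> x y
    using casimir_right[where h = y, OF linear_map_functional[where a = x, OF functional_mult_left[where h = d, OF that]]]
    by (simp add: scale_mult_left mult.assoc)
  have "(\<Sum>i\<in>I. \<mu> (d * b i) *s (a * b' i)) = (\<Sum>i\<in>I. \<mu> (d * b i) *s (d * a * b' i))"
    using assms(3) by (simp add: V_iff)
  also have "\<dots> = (\<Sum>i\<in>I. \<mu> (d * b i * a) *s (d * d * b' i))"
    unfolding d_idem by (rule move[OF assms(1)])
  also have "\<dots> = (\<Sum>i\<in>I. \<mu> (d * b i * d * a) *s (d * b' i))"
    by (rule move[OF functional_mult_right[OF assms(1)]])
  \<comment> \<open>As \<open>d * b i * d\<close> is a multiple of d and \<open>d * a = a\<close>,
    the form \<mu> enters only through the factor \<open>\<mu> a\<close>.\<close>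
  also have "\<dots> = (\<Sum>i\<in>I. \<mu> a *s (corner (b i) *s (d * b' i)))"
    using assms(1,3) by (simp add: corner scale_mult_left functional_scale V_iff mult.commute)
  also have "\<dots> = \<mu> a *s (\<Sum>i\<in>I. corner (b i) *s (d * b' i))"
    by (rule scale_sum_right[symmetric])
  also have "(\<Sum>i\<in>I. corner (b i) *s (d * b' i)) = schur_const *s d"
  proof -
    obtain c where "\<forall>v\<in>V. (\<Sum>i\<in>I. corner (v * b i) *s (d * b' i)) = c *s v"
      using scalar[OF functional_corner d_in_V] by blast
    then have "(\<Sum>i\<in>I. corner (d * b i) *s (d * b' i)) = c *s d" by simp
    moreover have "corner (d * h) = corner h" for h
      using corner[of h] d_idem by (intro corner_eqI) (simp flip: mult.assoc)
    ultimately have "(\<Sum>i\<in>I. corner (b i) *s (d * b' i)) = c *s d" by simp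
    then show ?thesis
      unfolding schur_const_def by (simp add: d_nonzero)
  qed
  finally have "(\<Sum>i\<in>I. \<mu> (d * b i) *s (a * b' i)) = (schur_const * \<mu> a) *s d"
    by (simp add: mult.commute)
  \<comment> \<open>So far only the argument d was treated. The averaged map is a scalar on V, and
    this scalar is determined by the value at d, which is nonzero.\<close>
  moreover obtain c where c: "\<forall>v\<in>V. (\<Sum>i\<in>I. \<mu> (v * b i) *s (a * b' i)) = c *s v"
    using scalar[OF assms(1,3)] by blast
  ultimately have "c = schur_const * \<mu> a"
    using d_in_V d_scale_eq_iff by metis
  with c assms(2) show ?thesis by simp
qed

text \<open>Left multiplication by d retracts the algebra onto V and so extends the coordinates on V
  to linear forms on the whole algebra.\<close>

lemma functional_coordinate:
  assumes "independent B" "span B = V"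
  shows "functional (\<lambda>x. representation B (d * x) a)"
  using assms
  by (auto simp: functional_def distrib_left scale_mult_right representation_add representation_scale)

text \<open>\<phi> is the sum over the basis of the rank-one maps sending v to its a-coordinate
  times \<open>\<phi> a\<close>, whose traces are the diagonal entries of \<phi>.\<close>

lemma averaged_linear_map:
  assumes "linear_map V V \<phi>" "v \<in> V"
  shows "(\<Sum>i\<in>I. \<phi> (v * b i) * b' i) = (schur_const * trace_on V \<phi>) *s v"
proof -
  obtain B where B: "finite B" "independent B" "span B = V"
    "\<And>\<phi>. trace_on V \<phi> = (\<Sum>b\<in>B. representation B (\<phi> b) b)"
    using trace_on_basis[OF V_module] by blast
  have BV: "a \<in> V" if "a \<in> B" for a using that B span_superset by blast
  have sub: "subspace V" using B by auto
  have \<phi>_sum: "\<phi> (\<Sum>a\<in>A. c a *s a) = (\<Sum>a\<in>A. c a *s \<phi> a)" if "A \<subseteq> B" for A c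
    using finite_subset[OF that B(1)] that
  proof (induction A rule: finite_induct)
    case empty
    have "\<phi> (0 *s 0) = 0 *s \<phi> 0"
      using assms(1) subspace_0[OF sub] unfolding linear_map_def by blast
    then show ?case by simp
  next
    case (insert a A)
    have "c a *s a \<in> V" "(\<Sum>a\<in>A. c a *s a) \<in> V" "a \<in> V"
      using insert BV sub by (auto intro!: subspace_sum subspace_scale)
    then have "\<phi> (c a *s a + (\<Sum>a\<in>A. c a *s a)) = c a *s \<phi> a + \<phi> (\<Sum>a\<in>A. c a *s a)"
      using assms(1) unfolding linear_map_def by metis
    with insert show ?case by simp
  qed
  have \<phi>_eq: "\<phi> x = (\<Sum>a\<in>B. representation B (d * x) a *s \<phi> a)" if "x \<in> V" for x
  proof -
    have "x = (\<Sum>a\<in>B. representation B x a *s a)"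
      using that B by (intro sum_representation_eq[symmetric]) auto
    then have "\<phi> x = (\<Sum>a\<in>B. representation B x a *s \<phi> a)"
      using \<phi>_sum[of B "representation B x"] by simp
    then show ?thesis using that by (simp add: V_iff)
  qed
  have "(\<Sum>i\<in>I. \<phi> (v * b i) * b' i)
      = (\<Sum>i\<in>I. \<Sum>a\<in>B. representation B (d * (v * b i)) a *s (\<phi> a * b' i))"
    using \<phi>_eq assms(2) by (simp add: scale_sum_mult)
  also have "\<dots> = (\<Sum>a\<in>B. \<Sum>i\<in>I. representation B (d * (v * b i)) a *s (\<phi> a * b' i))"
    by (rule sum.swap)
  also have "\<dots> = (\<Sum>a\<in>B. (schur_const * representation B (\<phi> a) a) *s v)"
  proof (rule sum.cong)
    fix a assume "a \<in> B"
    then have "\<phi> a \<in> V" using assms(1) BV by (simp add: linear_map_def)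
    then show "(\<Sum>i\<in>I. representation B (d * (v * b i)) a *s (\<phi> a * b' i))
        = (schur_const * representation B (\<phi> a) a) *s v"
      using averaged_rank_one[OF functional_coordinate[OF B(2,3)] assms(2), of "\<phi> a" a]
      by (simp add: V_iff)
  qed simp
  also have "\<dots> = (schur_const * trace_on V \<phi>) *s v"
    by (simp add: B(4) sum_distrib_left scale_sum_left)
  finally show ?thesis .
qed

lemma schur_const_eq:
  "(THE c. \<forall>\<phi>. linear_map V V \<phi> \<longrightarrow>
     (\<forall>v \<in> V. (\<Sum>i\<in>I. \<phi> (v * b i) * b' i) = (c * trace_on V \<phi>) *s v)) = schur_const"
proof (rule the_equality)
  fix c assume c: "\<forall>\<phi>. linear_map V V \<phi> \<longrightarrow>
     (\<forall>v \<in> V. (\<Sum>i\<in>I. \<phi> (v * b i) * b' i) = (c * trace_on V \<phi>) *s v)"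
  \<comment> \<open>A test map of trace 1: evaluated at d, it determines the constant.\<close>
  let ?\<phi> = "\<lambda>v. corner v *s d"
  have lin: "linear_map V V ?\<phi>"
    using functional_corner d_idem by (auto simp: linear_map_def functional_def scale_left_distrib V_iff scale_mult_right)
  have "trace_on V ?\<phi> = 1"
    using trace_on_rank_one[OF V_module functional_corner d_in_V, of ?\<phi>] by (simp add: corner_d)
  moreover have "(\<Sum>i\<in>I. ?\<phi> (d * b i) * b' i) = (c * trace_on V ?\<phi>) *s d"
    using c[rule_format, OF lin d_in_V] .
  ultimately show "c = schur_const"
    unfolding averaged_linear_map[OF lin d_in_V] by (simp add: d_nonzero)
qed (use averaged_linear_map in blast)

lemma character_basis:
  assumes "finite B" "independent B" "span B = V"
    "\<And>\<phi>. trace_on V \<phi> = (\<Sum>a\<in>B. representation B (\<phi> a) a)"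
  shows "character V (*) h = (\<Sum>a\<in>B. representation B (d * (a * h)) a)"
proof -
  have "d * (a * h) = a * h" if "a \<in> B" for a
    using that assms(3) span_superset[of B] V_iff by (auto simp flip: mult.assoc)
  then show ?thesis
    by (simp add: character_def assms(4))
qed

lemma functional_character: "functional (character V (*))"
proof -
  obtain B where B: "finite B" "independent B" "span B = V"
    "\<And>\<phi>. trace_on V \<phi> = (\<Sum>b\<in>B. representation B (\<phi> b) b)"
    using trace_on_basis[OF V_module] by blast
  have "functional (\<lambda>h. representation B (d * (a * h)) a)" for a
    using functional_mult_left[OF functional_coordinate[OF B(2,3), of a], of a] .
  then show ?thesis
    unfolding functional_def character_basis[OF B]
    by (simp add: sum.distrib sum_distrib_left)
qed

lemma character_commute: "character V (*) (x * y) = character V (*) (y * x)"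
proof -
  obtain B where B: "finite B" "independent B" "span B = V"
    "\<And>\<phi>. trace_on V \<phi> = (\<Sum>b\<in>B. representation B (\<phi> b) b)"
    using trace_on_basis[OF V_module] by blast
  let ?r = "representation B"
  have BV: "a \<in> V" if "a \<in> B" for a using that B span_superset by blast
  have BV_mult: "a * h \<in> span B" if "a \<in> B" for a h
    using V_mult[OF BV[OF that]] B(3) by simp
  \<comment> \<open>The scalars \<open>?r (a * x) c\<close> are the matrix entries of the right
    action of x; the trace of a matrix product is expanded.\<close>
  have *: "character V (*) (x * y) = (\<Sum>a\<in>B. \<Sum>c\<in>B. ?r (a * x) c * ?r (c * y) a)" for x y
  proof -
    have "?r (a * (x * y)) a = (\<Sum>c\<in>B. ?r (a * x) c * ?r (c * y) a)" if "a \<in> B" for a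
    proof -
      have ax: "a * x = (\<Sum>c\<in>B. ?r (a * x) c *s c)"
        using BV[OF that] B by (intro sum_representation_eq[symmetric]) auto
      have "a * (x * y) = (\<Sum>c\<in>B. ?r (a * x) c *s (c * y))"
        unfolding mult.assoc[symmetric] by (subst ax) (rule scale_sum_mult)
      also have "?r \<dots> a = (\<Sum>c\<in>B. ?r (?r (a * x) c *s (c * y)) a)"
        using B(2) BV_mult by (subst representation_sum) (auto intro!: span_scale)
      also have "\<dots> = (\<Sum>c\<in>B. ?r (a * x) c * ?r (c * y) a)"
        using B(2) BV_mult by (intro sum.cong) (auto simp: representation_scale)
      finally show ?thesis .
    qed
    then show ?thesis by (simp add: character_def B(4))
  qed
  show ?thesis
    unfolding *[of x y] *[of y x] by (subst sum.swap) (simp add: mult.commute)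
qed

lemma character_rank_one:
  assumes "\<And>v. v \<in> V \<Longrightarrow> v * h = \<mu> v *s d" "functional \<mu>"
  shows "character V (*) h = \<mu> d"
  unfolding character_def by (rule trace_on_rank_one[OF V_module assms(2) d_in_V assms(1)])

lemma mult_dual_character:
  "v * dual_element (character V (*)) = (\<Sum>i\<in>I. character V (*) (b i) *s (v * b' i))"
  by (simp add: dual_element_def mult_scale_sum)

text \<open>The character is a sum of diagonal coefficients, so the product is a sum of averaged
  rank-one maps. In each of them the basis vector a is the argument and v the target, which yields
  \<open>schur_const\<close> times the a-component of v.\<close>

lemma mult_dual_character_same:
  assumes "v \<in> V"
  shows "v * dual_element (character V (*)) = schur_const *s v"
proof -
  obtain B where B: "finite B" "independent B" "span B = V"
    "\<And>\<phi>. trace_on V \<phi> = (\<Sum>b\<in>B. representation B (\<phi> b) b)"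
    using trace_on_basis[OF V_module] by blast
  let ?r = "\<lambda>a x. representation B (d * x) a"
  have BV: "a \<in> V" if "a \<in> B" for a using that B span_superset by blast
  have "v * dual_element (character V (*)) = (\<Sum>a\<in>B. \<Sum>i\<in>I. ?r a (a * b i) *s (v * b' i))"
    unfolding mult_dual_character character_basis[OF B] scale_sum_left by (rule sum.swap)
  also have "\<dots> = (\<Sum>a\<in>B. (schur_const * representation B v a) *s a)"
    using averaged_rank_one[OF functional_coordinate[OF B(2,3)] BV assms] assms
    by (intro sum.cong) (auto simp: V_iff)
  also have "\<dots> = schur_const *s (\<Sum>a\<in>B. representation B v a *s a)"
    by (simp add: scale_sum_right)
  also have "(\<Sum>a\<in>B. representation B v a *s a) = v"
    using B assms by (intro sum_representation_eq) auto
  finally show ?thesis .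
qed

text \<open>The same sum of averages, but with values in the fixed space of \<open>d'\<close>: each
  summand is the value of a module map out of V, hence zero.\<close>

lemma mult_dual_character_other:
  assumes "\<And>\<phi> v. module_map V (*) {v. d' * v = v} (*) \<phi> \<Longrightarrow> v \<in> V \<Longrightarrow> \<phi> v = 0" "d' * v = v"
  shows "v * dual_element (character V (*)) = 0"
proof -
  obtain B where B: "finite B" "independent B" "span B = V"
    "\<And>\<phi>. trace_on V \<phi> = (\<Sum>b\<in>B. representation B (\<phi> b) b)"
    using trace_on_basis[OF V_module] by blast
  let ?r = "\<lambda>a x. representation B (d * x) a"
  have "v * dual_element (character V (*)) = (\<Sum>a\<in>B. \<Sum>i\<in>I. ?r a (a * b i) *s (v * b' i))"
    unfolding mult_dual_character character_basis[OF B] scale_sum_left by (rule sum.swap)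
  also have "\<dots> = 0"
  proof (rule sum.neutral, rule ballI)
    fix a assume "a \<in> B"
    then have "a \<in> V" using B span_superset by blast
    then show "(\<Sum>i\<in>I. ?r a (a * b i) *s (v * b' i)) = 0"
      by (rule assms(1)[OF averaged_module_map[OF functional_coordinate[OF B(2,3), of a] assms(2)]])
  qed
  finally show ?thesis .
qed

end

section \<open>The Hecke algebra as a symmetric algebra\<close>

context generic_hecke_algebra
begin

lemma relation:
  assumes "f \<in> hecke_ideal" "Poly_Mapping.keys f \<subseteq> lists S"
  shows "(\<Sum>ws \<in> Poly_Mapping.keys f. Poly_Mapping.lookup f ws *s prod_list (map T ws)) = 0"
  using T_relations[OF assms(2)] assms(1) by blast

lemma keys_single_lists: "ws \<in> lists S \<Longrightarrow> Poly_Mapping.keys (Poly_Mapping.single ws a) \<subseteq> lists S"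
  by simp

lemma keys_diff_lists:
  fixes p q :: "'w list \<Rightarrow>\<^sub>0 'k"
  assumes "Poly_Mapping.keys p \<subseteq> lists S" "Poly_Mapping.keys q \<subseteq> lists S"
  shows "Poly_Mapping.keys (p - q) \<subseteq> lists S"
proof -
  have "Poly_Mapping.keys (p - q) \<subseteq> Poly_Mapping.keys p \<union> Poly_Mapping.keys q"
    by (auto simp: in_keys_iff lookup_minus)
  with assms show ?thesis by blast
qed

lemma eval_diff:
  "(\<Sum>ws \<in> Poly_Mapping.keys (p - q). Poly_Mapping.lookup (p - q) ws *s prod_list (map T ws))
     = (\<Sum>ws \<in> Poly_Mapping.keys p. Poly_Mapping.lookup p ws *s prod_list (map T ws))
     - (\<Sum>ws \<in> Poly_Mapping.keys q. Poly_Mapping.lookup q ws *s prod_list (map T ws))"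
  by (rule sum_keys_diff[of "\<lambda>ws a. a *s prod_list (map T ws)"]) (rule scale_left_distrib)

lemma eval_single:
  "(\<Sum>ws \<in> Poly_Mapping.keys (Poly_Mapping.single vs a).
      Poly_Mapping.lookup (Poly_Mapping.single vs a) ws *s prod_list (map T ws)) = a *s prod_list (map T vs)"
  by (rule sum_keys_single[of "\<lambda>ws a. a *s prod_list (map T ws)"]) simp

section \<open>Multiplication rules for the standard basis\<close>

lemma T_quadratic:
  assumes "s \<in> S"
  shows "T s * T s = u s *s 1 + (u s - 1) *s T s"
proof -
  let ?p = "Poly_Mapping.single [s, s] 1 - Poly_Mapping.single [s] (u s - 1) - Poly_Mapping.single [] (u s)"
  have "?p \<in> hecke_ideal"
    using hecke_ideal.quadratic[OF hecke_ideal.zero assms, of "[]" "[]" 1] by simp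
  moreover have "Poly_Mapping.keys ?p \<subseteq> lists S"
    using assms by (intro keys_diff_lists keys_single_lists) auto
  ultimately have "T s * T s - (u s - 1) *s T s - u s *s 1 = 0"
    using relation[of ?p] unfolding eval_diff eval_single by simp
  then show ?thesis by (simp add: algebra_simps)
qed

lemma T_braid:
  assumes "s \<in> S" "t \<in> S" "s \<noteq> t"
  shows "prod_list (map T (alternating_word (ord (s \<otimes> t)) s t))
    = prod_list (map T (alternating_word (ord (s \<otimes> t)) t s))"
proof -
  let ?p = "Poly_Mapping.single (alternating_word (ord (s \<otimes> t)) s t) 1
    - Poly_Mapping.single (alternating_word (ord (s \<otimes> t)) t s) (1 :: 'k)"
  have "?p \<in> hecke_ideal"
    using hecke_ideal.braid[OF hecke_ideal.zero assms, of "[]" "[]" 1] by simp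
  moreover have "Poly_Mapping.keys ?p \<subseteq> lists S"
    using assms by (intro keys_diff_lists keys_single_lists alternating_word_in_lists)
  ultimately show ?thesis
    using relation[of ?p] unfolding eval_diff eval_single by simp
qed

lemma Tw_reduced_word: "reduced_word w ws \<Longrightarrow> Tw w = prod_list (map T ws)"
proof -
  assume ws: "reduced_word w ws"
  then have "w \<in> carrier W" by (auto simp: reduced_word_def)
  from matsumoto[of T, OF T_braid reduced_some_reduced_word[OF this] ws] show ?thesis
    by (simp add: Tw_def)
qed

lemma Tw_one [simp]: "Tw \<one> = 1"
  using Tw_reduced_word[of \<one> "[]"] by (simp add: reduced_word_def)

lemma T_Tw_ascent:
  assumes "s \<in> S" "w \<in> carrier W" "len w < len (s \<otimes> w)"
  shows "T s * Tw w = Tw (s \<otimes> w)"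
proof -
  obtain ws where ws: "reduced_word w ws" using assms reduced_word_exists by blast
  show ?thesis
    using Tw_reduced_word[OF reduced_word_Cons[OF assms(1) ws assms(3)]] Tw_reduced_word[OF ws] by simp
qed

lemma T_Tw_descent:
  assumes "s \<in> S" "w \<in> carrier W" "len (s \<otimes> w) < len w"
  shows "T s * Tw w = u s *s Tw (s \<otimes> w) + (u s - 1) *s Tw w"
proof -
  have w: "Tw w = T s * Tw (s \<otimes> w)"
    using T_Tw_ascent[of s "s \<otimes> w"] assms by simp
  have "T s * Tw w = (T s * T s) * Tw (s \<otimes> w)"
    by (simp add: w mult.assoc)
  also have "\<dots> = u s *s Tw (s \<otimes> w) + (u s - 1) *s (T s * Tw (s \<otimes> w))"
    by (simp add: T_quadratic[OF assms(1)] distrib_right scale_mult_left)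
  finally show ?thesis by (simp add: w)
qed

lemma Tw_T_ascent:
  assumes "s \<in> S" "w \<in> carrier W" "len w < len (w \<otimes> s)"
  shows "Tw w * T s = Tw (w \<otimes> s)"
proof -
  obtain ws where ws: "reduced_word w ws" using assms reduced_word_exists by blast
  then have "reduced_word (w \<otimes> s) (ws @ [s])"
    using assms len_mult_S[of s w] by (auto simp: reduced_word_def word_value_append)
  from Tw_reduced_word[OF this] Tw_reduced_word[OF ws] show ?thesis by simp
qed

section \<open>Spanning and linear independence of the standard basis\<close>

lemma T_mult_span:
  assumes "s \<in> S" "h \<in> span (Tw ` carrier W)"
  shows "T s * h \<in> span (Tw ` carrier W)"
  using assms(2)
proof (induction rule: span_induct_alt)
  case base
  show ?case by (simp add: span_zero)
next
  case (step c x y)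
  from step(1) obtain w where w: "w \<in> carrier W" "x = Tw w" by blast
  have base: "Tw v \<in> span (Tw ` carrier W)" if "v \<in> carrier W" for v
    using that by (intro span_base) blast
  have "T s * x \<in> span (Tw ` carrier W)"
  proof (cases "len w < len (s \<otimes> w)")
    case True
    then show ?thesis using T_Tw_ascent[OF assms(1) w(1)] w base assms(1) by simp
  next
    case False
    then have "len (s \<otimes> w) < len w" using len_S_mult[OF assms(1) w(1)] by linarith
    then show ?thesis
      using T_Tw_descent[OF assms(1) w(1)] w base assms(1) by (simp add: span_add span_scale)
  qed
  with step show ?case by (simp add: distrib_left scale_mult_right span_add span_scale)
qed

lemma span_Tw: "h \<in> span (Tw ` carrier W)"
proof -
  have word: "prod_list (map T ws) \<in> span (Tw ` carrier W)" if "ws \<in> lists S" for ws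
    using that
  proof (induction ws)
    case Nil
    then show ?case using span_base[OF imageI[of \<one> "carrier W" Tw]] by simp
  next
    case (Cons s ws)
    then show ?case using T_mult_span by simp
  qed
  obtain f where "Poly_Mapping.keys f \<subseteq> lists S"
    "h = (\<Sum>ws \<in> Poly_Mapping.keys f. Poly_Mapping.lookup f ws *s prod_list (map T ws))"
    using T_generate by blast
  with word show ?thesis by (auto intro!: span_sum span_scale)
qed

lemma Tw_induct:
  assumes "\<And>w. w \<in> carrier W \<Longrightarrow> P (Tw w)" "P 0" "\<And>x y c. P x \<Longrightarrow> P y \<Longrightarrow> P (c *s x + y)"
  shows "P h"
  using span_Tw[of h] by (induction rule: span_induct_alt) (use assms in auto)

lemma Tw_expansion: "\<exists>a. h = (\<Sum>w \<in> carrier W. a w *s Tw w)"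
proof (induction h rule: Tw_induct)
  case (1 w)
  have "(if v = w then 1 else 0) *s Tw v = (if v = w then Tw v else 0)" for v
    by simp
  with 1 finite_carrier show ?case
    by (intro exI[of _ "\<lambda>v. if v = w then 1 else 0"]) simp
next
  case 2
  show ?case by (intro exI[of _ "\<lambda>v. 0"]) simp
next
  case (3 x y c)
  then obtain f g where "x = (\<Sum>w \<in> carrier W. f w *s Tw w)" "y = (\<Sum>w \<in> carrier W. g w *s Tw w)" by blast
  then show ?case
    by (intro exI[of _ "\<lambda>w. c * f w + g w"]) (simp add: scale_left_distrib sum.distrib scale_sum_right)
qed

text \<open>A relation lifts to a combination p of the chosen reduced words; p then lies in
  \<open>hecke_ideal\<close> and annihilates \<open>delta \<one>\<close>. The reduced word of w
  sends \<open>delta \<one>\<close> to \<open>delta w\<close>, so evaluation at x returns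
  \<open>a x\<close>.\<close>

lemma Tw_independent:
  assumes "(\<Sum>w \<in> carrier W. a w *s Tw w) = 0" "x \<in> carrier W"
  shows "a x = 0"
proof -
  define p where "p = (\<Sum>w \<in> carrier W. Poly_Mapping.single (some_reduced_word w) (a w))"
  have red: "reduced_word w (some_reduced_word w)" if "w \<in> carrier W" for w
    using that by (rule reduced_some_reduced_word)
  have "Poly_Mapping.keys p \<subseteq> some_reduced_word ` carrier W"
    unfolding p_def using Poly_Mapping.keys_sum[of "\<lambda>w. Poly_Mapping.single (some_reduced_word w) (a w)" "carrier W"]
    by (auto split: if_splits)
  then have keys: "Poly_Mapping.keys p \<subseteq> lists S"
    using red by (auto simp: reduced_word_def)
  have eval: "(\<Sum>ws \<in> Poly_Mapping.keys p. F ws (Poly_Mapping.lookup p ws)) = (\<Sum>w \<in> carrier W. F (some_reduced_word w) (a w))"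
    if "\<And>ws. F ws 0 = 0" "\<And>ws a b. F ws (a + b) = F ws a + F ws b" for F :: "'w list \<Rightarrow> 'k \<Rightarrow> 'z::comm_monoid_add"
    unfolding p_def using that by (subst sum_keys_sum) (auto simp: sum_keys_single simp del: keys_single)
  have "(\<Sum>ws \<in> Poly_Mapping.keys p. Poly_Mapping.lookup p ws *s prod_list (map T ws)) = 0"
    using eval[of "\<lambda>ws c. c *s prod_list (map T ws)"] assms(1) by (simp add: scale_left_distrib Tw_def)
  then have "p \<in> hecke_ideal"
    using T_relations[OF keys] by blast
  then have "(\<Sum>w \<in> carrier W. a w * word_op (some_reduced_word w) (delta \<one>) x) = 0"
    using hecke_ideal_acts_zero[of p x "delta \<one>"] assms(2)
      eval[of "\<lambda>ws c. c * word_op ws (delta \<one>) x"] by (simp add: distrib_right)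
  moreover have "a w * word_op (some_reduced_word w) (delta \<one>) x = (if x = w then a w else 0)"
    if "w \<in> carrier W" for w
    using word_op_reduced_delta[OF red[OF that]] assms(2) by (simp add: agree_def delta_def)
  ultimately show ?thesis
    using assms(2) finite_carrier by simp
qed

lemma Tw_expansion_unique:
  assumes "(\<Sum>w \<in> carrier W. f w *s Tw w) = (\<Sum>w \<in> carrier W. g w *s Tw w)" "x \<in> carrier W"
  shows "f x = g x"
  using Tw_independent[of "\<lambda>w. f w - g w" x] assms by (simp add: scale_left_diff_distrib sum_subtractf)

section \<open>The symmetrizing trace\<close>

definition trace_form :: "'h \<Rightarrow> 'k" where
  "trace_form h = (SOME a. h = (\<Sum>w \<in> carrier W. a w *s Tw w)) \<one>"

text \<open>The coefficient function picked by \<open>SOME\<close> is arbitrary outside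
  \<open>carrier W\<close>, but its value at \<one> is determined by linear independence.\<close>

lemma trace_form_expansion: "trace_form (\<Sum>w \<in> carrier W. a w *s Tw w) = a \<one>"
proof -
  let ?h = "\<Sum>w \<in> carrier W. a w *s Tw w"
  have "?h = (\<Sum>w \<in> carrier W. (SOME a. ?h = (\<Sum>w \<in> carrier W. a w *s Tw w)) w *s Tw w)"
    using someI_ex[OF Tw_expansion[of ?h]] .
  from Tw_expansion_unique[OF this, of \<one>] show ?thesis
    by (simp add: trace_form_def)
qed

lemma functional_trace_form: "functional trace_form"
  unfolding functional_def
proof (intro conjI allI)
  fix x y c
  obtain f g where x: "x = (\<Sum>w \<in> carrier W. f w *s Tw w)" and y: "y = (\<Sum>w \<in> carrier W. g w *s Tw w)"
    using Tw_expansion by metis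
  have "x + y = (\<Sum>w \<in> carrier W. (f w + g w) *s Tw w)"
    by (simp add: x y scale_left_distrib sum.distrib)
  then show "trace_form (x + y) = trace_form x + trace_form y"
    using trace_form_expansion[of "\<lambda>w. f w + g w"] trace_form_expansion[of f] trace_form_expansion[of g]
    by (simp add: x y)
  have "c *s x = (\<Sum>w \<in> carrier W. (c * f w) *s Tw w)"
    by (simp add: x scale_sum_right)
  then show "trace_form (c *s x) = c * trace_form x"
    using trace_form_expansion[of "\<lambda>w. c * f w"] trace_form_expansion[of f] by (simp add: x)
qed

lemma trace_form_Tw:
  assumes "w \<in> carrier W"
  shows "trace_form (Tw w) = (if w = \<one> then 1 else 0)"
proof -
  have "(if v = w then 1 else 0) *s Tw v = (if v = w then Tw v else 0)" for v
    by simp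
  then have "Tw w = (\<Sum>v \<in> carrier W. (if v = w then 1 else 0) *s Tw v)"
    using assms finite_carrier by simp
  then show ?thesis
    using trace_form_expansion[of "\<lambda>v. if v = w then 1 else 0"] by auto
qed

text \<open>Induction on the length of x moves its last letter s over to y. Since mutually inverse
  elements have equal length, at most one term of \<open>T s * Tw y\<close> pairs nontrivially with
  \<open>Tw v\<close>.\<close>

lemma trace_form_Tw_mult:
  assumes "x \<in> carrier W" "y \<in> carrier W"
  shows "trace_form (Tw x * Tw y) = (if x \<otimes> y = \<one> then uw x else 0)"
  using assms
proof (induction "len x" arbitrary: x y)
  case 0
  then have "x = \<one>" by (simp add: len_eq_0)
  with 0 show ?case by (simp add: trace_form_Tw)
next
  case (Suc n)
  then obtain v s where v: "v \<in> carrier W" "s \<in> S" "x = v \<otimes> s" "len v = n"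
    using right_descent_exists[of x n] by metis
  have vx: "len v < len (v \<otimes> s)" using v Suc by simp
  have assoc: "x \<otimes> y = v \<otimes> (s \<otimes> y)" using v Suc.prems by (simp add: m_assoc)
  have x: "Tw x * Tw y = Tw v * (T s * Tw y)"
    unfolding v(3) by (simp add: mult.assoc flip: Tw_T_ascent[OF v(2,1) vx])
  have IH: "trace_form (Tw v * Tw z) = (if v \<otimes> z = \<one> then uw v else 0)" if "z \<in> carrier W" for z
    using Suc.hyps(1)[of v z] v that by simp
  have len_eq: "len b = len a" if "a \<otimes> b = \<one>" "a \<in> carrier W" "b \<in> carrier W" for a b
    using that len_inv[of b] inv_equality[of a b] by simp
  have sy: "s \<otimes> y \<in> carrier W" using v Suc.prems by simp
  show ?case
  proof (cases "len y < len (s \<otimes> y)")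
    case True
    \<comment> \<open>\<open>x \<otimes> y = \<one>\<close> would force \<open>len y = Suc n\<close>
      and \<open>len (s \<otimes> y) = n\<close>, contrary to the ascent.\<close>
    then have "x \<otimes> y \<noteq> \<one>"
      using len_eq[of x y] len_eq[of v "s \<otimes> y"] Suc v sy unfolding assoc by fastforce
    then show ?thesis
      using IH[OF sy] T_Tw_ascent[OF v(2) Suc.prems(2) True] unfolding x assoc by simp
  next
    case False
    then have less: "len (s \<otimes> y) < len y"
      using len_S_mult[OF v(2) Suc.prems(2)] by linarith
    \<comment> \<open>The term \<open>Tw y\<close> from the quadratic relation contributes nothing:
      \<open>v \<otimes> y = \<one>\<close> would force \<open>len y = n\<close> and
      \<open>len (s \<otimes> y) = Suc n\<close>.\<close>
    have "v \<otimes> y \<noteq> \<one>"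
    proof
      assume vy: "v \<otimes> y = \<one>"
      then have "x \<otimes> (s \<otimes> y) = \<one>"
        using v Suc.prems by (simp add: m_assoc)
      then show False
        using len_eq[of v y] len_eq[of x "s \<otimes> y"] vy less v Suc sy by simp
    qed
    moreover have "uw x = u s * uw v"
    proof -
      \<comment> \<open>\<open>uw_mult\<close> splits off a first letter, so the last letter of x is
        reached through the inverse.\<close>
      have "uw x = uw (s \<otimes> inv v)"
        using uw_inv[of x] v by (simp add: inv_mult_group)
      also have "\<dots> = u s * uw (inv v)"
        using v vx by (intro uw_mult) (simp_all add: len_mult_S_inv)
      finally show ?thesis using v by (simp add: uw_inv)
    qed
    ultimately show ?thesis
      using IH[OF sy] IH[OF Suc.prems(2)] functional_trace_form
      unfolding x T_Tw_descent[OF v(2) Suc.prems(2) less] assoc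
      by (simp add: distrib_left scale_mult_right functional_add functional_scale)
  qed
qed

lemma trace_form_commute: "trace_form (x * y) = trace_form (y * x)"
proof -
  have Tw: "trace_form (Tw v * Tw w) = trace_form (Tw w * Tw v)" if "v \<in> carrier W" "w \<in> carrier W" for v w
  proof -
    have "v \<otimes> w = \<one> \<longleftrightarrow> w \<otimes> v = \<one>"
      using that inv_comm by blast
    moreover have "uw v = uw w" if "v \<otimes> w = \<one>"
      using that \<open>v \<in> _\<close> \<open>w \<in> _\<close> uw_inv[of w] inv_equality[of v w] by simp
    ultimately show ?thesis
      using that by (simp add: trace_form_Tw_mult)
  qed
  have bilinear: "trace_form ((c *s x + y) * z) = c * trace_form (x * z) + trace_form (y * z)"
    "trace_form (z * (c *s x + y)) = c * trace_form (z * x) + trace_form (z * y)" for c x y z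
    using functional_trace_form
    by (simp_all add: distrib_left distrib_right scale_mult_left scale_mult_right functional_add functional_scale)
  have "trace_form (Tw v * y) = trace_form (y * Tw v)" if "v \<in> carrier W" for v
    by (induction y rule: Tw_induct) (simp_all add: Tw that bilinear)
  then show ?thesis
    by (induction x rule: Tw_induct) (simp_all add: bilinear)
qed

lemma Tw_dual_pairing:
  assumes "v \<in> carrier W" "w \<in> carrier W"
  shows "trace_form (Tw_dual v * Tw w) = (if v = w then 1 else 0)"
proof -
  have "inv v \<otimes> w = \<one> \<longleftrightarrow> v = w"
    using assms by (metis inv_closed inv_equality inv_inv l_inv)
  then show ?thesis
    using assms functional_trace_form uw_nonzero[of w]
    by (simp add: Tw_dual_def scale_mult_left functional_scale trace_form_Tw_mult uw_inv)
qed

lemma expand_Tw: "(\<Sum>w \<in> carrier W. trace_form (Tw_dual w * h) *s Tw w) = h"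
proof (induction h rule: Tw_induct)
  case (1 v)
  have "trace_form (Tw_dual w * Tw v) *s Tw w = (if w = v then Tw w else 0)" if "w \<in> carrier W" for w
    using 1 that by (simp add: Tw_dual_pairing)
  with 1 finite_carrier show ?case by simp
next
  case (3 x y c)
  then show ?case
    using functional_trace_form
    by (simp add: distrib_left scale_mult_right functional_add functional_scale scale_left_distrib
        sum.distrib flip: scale_scale scale_sum_right)
qed (use functional_zero[OF functional_trace_form] in simp)

lemma expand_Tw_dual: "(\<Sum>w \<in> carrier W. trace_form (Tw w * h) *s Tw_dual w) = h"
proof (induction h rule: Tw_induct)
  case (1 v)
  have eq: "w \<otimes> v = \<one> \<longleftrightarrow> w = inv v" if "w \<in> carrier W" for w
    using 1 that by (metis inv_equality l_inv)
  have "trace_form (Tw w * Tw v) *s Tw_dual w = (if w = inv v then Tw v else 0)" if "w \<in> carrier W" for w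
    using 1 that eq[OF that] uw_nonzero[of v]
    by (auto simp: trace_form_Tw_mult Tw_dual_def uw_inv)
  with 1 finite_carrier show ?case by simp
next
  case (3 x y c)
  then show ?case
    using functional_trace_form
    by (simp add: distrib_left scale_mult_right functional_add functional_scale scale_left_distrib
        sum.distrib flip: scale_scale scale_sum_right)
qed (use functional_zero[OF functional_trace_form] in simp)

sublocale symmetric_algebra scale trace_form "carrier W" Tw Tw_dual
  by unfold_locales (fact functional_trace_form trace_form_commute expand_Tw expand_Tw_dual)+

lemma dual_element_eq_star: "dual_element f = star f"
  by (simp add: dual_element_def star_def)


section \<open>Parabolic idempotents\<close>

text \<open>Multiplication by s pairs the elements A that it lengthens with the elements D that it
  shortens. A contributes the sum of \<open>Tw w\<close> over D, which cancels the -1 in the factor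
  \<open>u s - 1\<close> arising from D.\<close>

lemma T_mult_parabolic_sum:
  assumes "J \<subseteq> S" "s \<in> J"
  shows "T s * (\<Sum>w \<in> generate W J. Tw w) = u s *s (\<Sum>w \<in> generate W J. Tw w)"
proof -
  let ?G = "generate W J"
  have s: "s \<in> S" using assms by blast
  have G: "?G \<subseteq> carrier W" "finite ?G"
    using assms S_subset finite_carrier generate_incl[of J] by (auto intro: finite_subset)
  have sG: "s \<otimes> w \<in> ?G" if "w \<in> ?G" for w
    using generate.eng[OF generate.incl[OF assms(2)] that] .
  define D where "D = {w \<in> ?G. len (s \<otimes> w) < len w}"
  define A where "A = {w \<in> ?G. len w < len (s \<otimes> w)}"
  have "len (s \<otimes> w) < len w \<or> len w < len (s \<otimes> w)" if "w \<in> ?G" for w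
    using len_S_mult[OF s, of w] G that by auto
  then have union: "?G = A \<union> D"
    unfolding A_def D_def by blast
  have disjoint: "A \<inter> D = {}"
    unfolding A_def D_def using less_asym by blast
  have fin: "finite A" "finite D"
    using G(2) unfolding union by (blast intro: finite_subset)+
  have AD: "sum f A = (\<Sum>w\<in>D. f (s \<otimes> w))" for f :: "'w \<Rightarrow> 'h"
    using s sG G
    by (intro sum.reindex_bij_witness[of _ "\<lambda>w. s \<otimes> w" "\<lambda>w. s \<otimes> w"]) (auto simp: A_def D_def subset_eq)
  have "T s * (\<Sum>w \<in> ?G. Tw w) = (\<Sum>w\<in>A. T s * Tw w) + (\<Sum>w\<in>D. T s * Tw w)"
    unfolding union sum.union_disjoint[OF fin disjoint] distrib_left sum_distrib_left ..
  also have "(\<Sum>w\<in>A. T s * Tw w) = (\<Sum>w\<in>D. Tw w)"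
    unfolding AD
  proof (rule sum.cong)
    fix w assume "w \<in> D"
    then show "T s * Tw (s \<otimes> w) = Tw w"
      using T_Tw_ascent[of s "s \<otimes> w"] s G by (auto simp: D_def)
  qed simp
  also have "(\<Sum>w\<in>D. T s * Tw w) = (\<Sum>w\<in>D. u s *s Tw (s \<otimes> w) + (u s - 1) *s Tw w)"
    using T_Tw_descent[OF s] G by (intro sum.cong) (auto simp: D_def)
  also have "(\<Sum>w\<in>D. Tw w) + \<dots> = u s *s ((\<Sum>w\<in>D. Tw (s \<otimes> w)) + (\<Sum>w\<in>D. Tw w))"
    by (simp add: sum.distrib scale_right_distrib scale_left_diff_distrib sum_subtractf scale_sum_right)
  also have "(\<Sum>w\<in>D. Tw (s \<otimes> w)) + (\<Sum>w\<in>D. Tw w) = (\<Sum>w \<in> ?G. Tw w)"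
    unfolding union sum.union_disjoint[OF fin disjoint] AD ..
  finally show ?thesis .
qed

lemma Tw_mult_parabolic_sum:
  assumes "J \<subseteq> S" "w \<in> generate W J"
  shows "Tw w * (\<Sum>w \<in> generate W J. Tw w) = uw w *s (\<Sum>w \<in> generate W J. Tw w)"
proof -
  have "prod_list (map T ws) * (\<Sum>w \<in> generate W J. Tw w) = prod_list (map u ws) *s (\<Sum>w \<in> generate W J. Tw w)"
    if "ws \<in> lists J" for ws
    using that
  proof (induction ws)
    case (Cons s ws)
    then show ?case
      using T_mult_parabolic_sum[OF assms(1), of s]
      by (simp add: mult.assoc scale_mult_right)
  qed simp
  \<comment> \<open>A word that is reduced and also uses only letters of J identifies the eigenvalue
    with \<open>uw w\<close>.\<close>
  moreover obtain ws where "ws \<in> lists J" "reduced_word w ws"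
    using reduced_word_parabolic[OF assms] by blast
  ultimately show ?thesis
    using Tw_reduced_word[of w ws] uw_reduced_word[of w ws] by simp
qed

lemma e_idempotent:
  assumes "J \<subseteq> S"
  shows "e J * e J = e J"
proof -
  let ?X = "\<Sum>w \<in> generate W J. Tw w"
  have "?X * ?X = (\<Sum>w \<in> generate W J. uw w *s ?X)"
    unfolding sum_distrib_right[of Tw] by (rule sum.cong) (auto simp: Tw_mult_parabolic_sum[OF assms])
  also have "\<dots> = poincare J *s ?X"
    by (simp add: poincare_def scale_sum_left)
  finally show ?thesis
    using poincare_nonzero[OF assms] by (simp add: e_def scale_mult_left scale_mult_right)
qed

end

section \<open>Zonal spherical functions\<close>

theorem theorem3p3:
  fixes W :: "('w, 'b) monoid_scheme" (structure)
    and S J :: "'w set"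
    and \<iota> :: "complex \<Rightarrow> 'k::field"
    and u :: "'w \<Rightarrow> 'k"
    and scale :: "'k \<Rightarrow> 'h::ring_1 \<Rightarrow> 'h" (infixr \<open>*s\<close> 75)
    and T :: "'w \<Rightarrow> 'h"
    and V :: "nat \<Rightarrow> 'h set"
    and r :: nat
    and \<chi> :: "nat \<Rightarrow> 'h \<Rightarrow> 'k"
    and c :: "nat \<Rightarrow> 'k"
    and \<omega> :: "nat \<Rightarrow> 'h"
  assumes "generic_hecke_algebra W S \<iota> u scale T"
    and "J \<subseteq> S"
    and "generic_hecke_algebra.gelfand_pair W S u scale T J"
    and "k_algebra.simple_decomposition scale r V (generic_hecke_algebra.eH W S u scale T J) (*)"
    and "\<And>i. i \<in> {1..r} \<Longrightarrow> \<chi> i = k_algebra.character scale (V i) (*)"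
    and "\<And>i. i \<in> {1..r} \<Longrightarrow> c i = generic_hecke_algebra.schur_element W S u scale T (V i) (*)"
    and "\<And>i. i \<in> {1..r} \<Longrightarrow> \<omega> i =
           generic_hecke_algebra.star W S u scale T (\<chi> i) * generic_hecke_algebra.e W S u scale T J"
  shows "(\<forall>i \<in> {1..r}. \<omega> i =
             generic_hecke_algebra.e W S u scale T J * generic_hecke_algebra.star W S u scale T (\<chi> i)) \<and>
         (\<forall>i \<in> {1..r}.
             (\<exists>a. \<omega> i = (\<Sum>w \<in> carrier W. a w *s generic_hecke_algebra.Tw W S T w)) \<and>
             (\<forall>a. \<omega> i = (\<Sum>w \<in> carrier W. a w *s generic_hecke_algebra.Tw W S T w) \<longrightarrow> a \<one> = 1)) \<and>
         (\<forall>i \<in> {1..r}. \<forall>j \<in> {1..r}. \<omega> i * \<omega> j = (if i = j then c i *s \<omega> i else 0)) \<and>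
         (\<forall>i \<in> {1..r}. \<omega> i \<in> generic_hecke_algebra.eHe W S u scale T J \<inter> V i) \<and>
         (inj_on \<omega> {1..r} \<and> \<not> module.dependent scale (\<omega> ` {1..r}) \<and>
          module.span scale (\<omega> ` {1..r}) = generic_hecke_algebra.eHe W S u scale T J)"
proof -
  interpret generic_hecke_algebra W S \<iota> u scale T by fact
  note dec = assms(4)[unfolded eH_def]
  note gelfand = assms(3)[unfolded gelfand_pair_def eH_def]
  note idem = e_idempotent[OF assms(2)]

  \<comment> \<open>The components of \<open>e J\<close>\<close>
  obtain d where d_sum: "e J = (\<Sum>i\<in>{1..r}. d i)"
    and d_V: "\<And>i. i \<in> {1..r} \<Longrightarrow> d i \<in> V i" and d_nonzero: "\<And>i. i \<in> {1..r} \<Longrightarrow> d i \<noteq> 0"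
    and ed: "\<And>i. i \<in> {1..r} \<Longrightarrow> e J * d i = d i" and de: "\<And>i. i \<in> {1..r} \<Longrightarrow> d i * e J = d i"
    and dd: "\<And>i j. i \<in> {1..r} \<Longrightarrow> j \<in> {1..r} \<Longrightarrow> d i * d j = (if i = j then d i else 0)"
    and V_eq: "\<And>i. i \<in> {1..r} \<Longrightarrow> V i = {v. d i * v = v}"
    using idempotent_components[OF dec idem] by blast
  have simple: "simple_module (V i) (*)" if "i \<in> {1..r}" for i
    using dec that unfolding simple_decomposition_def by blast
  have split: "split_idempotent scale trace_form (carrier W) Tw Tw_dual (d i) (V i)" if i: "i \<in> {1..r}" for i
  proof unfold_locales
    show "right_module (V i) (*)"
      using simple[OF i] by (simp add: simple_module_def)
    show "\<exists>c. \<forall>v\<in>V i. \<phi> v = c *s v" if "module_map (V i) (*) (V i) (*) \<phi>" for \<phi>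
      using split_semisimple simple[OF i] that unfolding split_semisimple_def by blast
  qed (use V_eq dd d_nonzero i in auto)
  have hom_zero: "\<phi> v = 0" if "i \<in> {1..r}" "j \<in> {1..r}" "i \<noteq> j" "module_map (V i) (*) (V j) (*) \<phi>" "v \<in> V i"
    for i j \<phi> v
    using simple_module_map_zero[OF simple simple multiplicity_free_not_isomorphic[OF gelfand dec]] that by blast
  have off_diagonal: "d i * h * d j = 0" if ij: "i \<in> {1..r}" "j \<in> {1..r}" "i \<noteq> j" for i j h
  proof -
    have "d i * (d i * x) = d i * x" for x
      using dd[OF ij(1,1)] by (simp flip: mult.assoc)
    then have "module_map (V j) (*) (V i) (*) (\<lambda>v. d i * h * d j * v)"
      unfolding V_eq[OF ij(1)] module_map_def linear_map_def
      by (simp add: distrib_left scale_mult_right mult.assoc)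
    \<comment> \<open>The module map is evaluated at the element \<open>d j\<close> of its
      source.\<close>
    then have "d i * h * d j * d j = 0"
      by (rule hom_zero[OF ij(2,1) ij(3)[symmetric] _ d_V[OF ij(2)]])
    then show ?thesis
      using dd[OF ij(2,2)] by (simp add: mult.assoc)
  qed
  define \<kappa> where "\<kappa> i = split_idempotent.corner scale (d i)" for i
  have corner: "d i * h * e J = \<kappa> i h *s d i" if i: "i \<in> {1..r}" for i h
  proof -
    have "d i * h * e J = (\<Sum>j\<in>{1..r}. d i * h * d j)"
      by (simp add: d_sum sum_distrib_left)
    also have "\<dots> = (\<Sum>j\<in>{1..r}. if j = i then d i * h * d i else 0)"
      using off_diagonal[OF i] by (intro sum.cong) auto
    also have "\<dots> = d i * h * d i"
      using i by simp
    finally show ?thesis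
      using split_idempotent.corner[OF split[OF i]] by (simp add: \<kappa>_def)
  qed

  \<comment> \<open>Action of the dual characters\<close>
  have schur: "c i = split_idempotent.schur_const scale (carrier W) Tw Tw_dual (d i)" if i: "i \<in> {1..r}" for i
    using split_idempotent.schur_const_eq[OF split[OF i]] assms(6)[OF i] by (simp add: schur_element_def)
  have star: "star (\<chi> i) = dual_element (character (V i) (*))" if "i \<in> {1..r}" for i
    using assms(5)[OF that] by (simp add: dual_element_eq_star)
  have central: "star (\<chi> i) * h = h * star (\<chi> i)" if i: "i \<in> {1..r}" for i h
    unfolding star[OF i]
    by (intro dual_element_central[symmetric] split_idempotent.functional_character[OF split[OF i]]
        split_idempotent.character_commute[OF split[OF i]])
  have d_star: "d j * star (\<chi> i) = (if j = i then c i *s d i else 0)" if ij: "i \<in> {1..r}" "j \<in> {1..r}" for i j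
  proof (cases "j = i")
    case True
    then show ?thesis
      using split_idempotent.mult_dual_character_same[OF split[OF ij(1)] d_V[OF ij(1)]]
      by (simp add: star[OF ij(1)] schur[OF ij(1)])
  next
    case False
    have "d j * dual_element (character (V i) (*)) = 0"
    proof (rule split_idempotent.mult_dual_character_other[OF split[OF ij(1)], of "d j"])
      show "\<phi> v = 0" if "module_map (V i) (*) {v. d j * v = v} (*) \<phi>" "v \<in> V i" for \<phi> v
        using hom_zero[of i j \<phi> v] False ij that V_eq by auto
    qed (use dd ij in simp)
    with False show ?thesis by (simp add: star[OF ij(1)])
  qed
  \<comment> \<open>In this order each component \<open>d j\<close> of \<open>e J\<close> stands
    directly to the left of the dual character, where \<open>d_star\<close> evaluates the
    product.\<close>
  have \<omega>_comm: "\<omega> i = e J * star (\<chi> i)" if "i \<in> {1..r}" for i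
    using assms(7)[OF that] central[OF that] by simp
  have \<omega>: "\<omega> i = c i *s d i" if i: "i \<in> {1..r}" for i
  proof -
    have "\<omega> i = (\<Sum>j\<in>{1..r}. if j = i then c i *s d i else 0)"
      unfolding \<omega>_comm[OF i] d_sum sum_distrib_right using d_star[OF i] by (intro sum.cong) auto
    then show ?thesis using i by simp
  qed
  have trace: "trace_form (\<omega> i) = 1" if i: "i \<in> {1..r}" for i
  proof -
    interpret V: split_idempotent scale trace_form "carrier W" Tw Tw_dual "d i" "V i"
      by (rule split[OF i])
    have "trace_form (\<omega> i) = character (V i) (*) (e J)"
      unfolding assms(7)[OF i] star[OF i] by (rule trace_dual_element[OF V.functional_character])
    also have "\<dots> = \<kappa> i (d i)"
    proof (rule V.character_rank_one)
      \<comment> \<open>As \<open>d i * v = v\<close>, the formula for \<open>d i * v * e J\<close>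
        describes right multiplication of v by \<open>e J\<close>.\<close>
      show "v * e J = \<kappa> i v *s d i" if "v \<in> V i" for v
        using corner[OF i, of v] that V.V_iff by simp
      show "functional (\<kappa> i)"
        unfolding \<kappa>_def by (rule V.functional_corner)
    qed
    also have "\<dots> = 1"
      unfolding \<kappa>_def by (rule V.corner_d)
    finally show ?thesis .
  qed
  have c_nonzero: "c i \<noteq> 0" if "i \<in> {1..r}" for i
    using trace[OF that] \<omega>[OF that] functional_zero[OF functional_trace_form] by auto
  have \<omega>_nonzero: "\<omega> i \<noteq> 0" if "i \<in> {1..r}" for i
    using trace[OF that] functional_zero[OF functional_trace_form] by auto

  \<comment> \<open>Orthogonality and the basis property\<close>
  have mult: "\<omega> i * \<omega> j = (if i = j then c i *s \<omega> i else 0)" if "i \<in> {1..r}" "j \<in> {1..r}" for i j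
    using dd[OF that] \<omega> that by (simp add: scale_mult_left scale_mult_right)
  have inj: "inj_on \<omega> {1..r}"
  proof (rule inj_onI, rule ccontr)
    fix i j assume ij: "i \<in> {1..r}" "j \<in> {1..r}" "\<omega> i = \<omega> j" "i \<noteq> j"
    \<comment> \<open>Equality would identify \<open>\<omega> i * \<omega> i\<close>, which is
      \<open>c i *s \<omega> i\<close>, with \<open>\<omega> i * \<omega> j\<close>, which is
      0.\<close>
    then have "c i *s \<omega> i = 0"
      using mult[of i i] mult[of i j] by simp
    with ij c_nonzero \<omega>_nonzero show False by simp
  qed
  have eHe: "\<omega> i \<in> eHe J" if "i \<in> {1..r}" for i
    using \<omega>[OF that] ed[OF that] de[OF that]
    unfolding eHe_def by (auto intro!: exI[of _ "c i *s d i"] simp: scale_mult_left scale_mult_right)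
  have indep: "independent (\<omega> ` {1..r})"
  proof (rule independent_if_scalars_zero)
    fix f x assume sum: "(\<Sum>x\<in>\<omega> ` {1..r}. f x *s x) = 0" and "x \<in> \<omega> ` {1..r}"
    then obtain j where j: "j \<in> {1..r}" "x = \<omega> j" by blast
    \<comment> \<open>Right multiplication by \<open>\<omega> j\<close> isolates the j-th term of
      the relation.\<close>
    have "0 = (\<Sum>i\<in>{1..r}. f (\<omega> i) *s \<omega> i) * \<omega> j"
      using sum unfolding sum.reindex[OF inj] by simp
    also have "\<dots> = (\<Sum>i\<in>{1..r}. if i = j then (f x * c j) *s \<omega> j else 0)"
      unfolding scale_sum_mult using mult[OF _ j(1)] j(2) by (intro sum.cong) auto
    also have "\<dots> = (f x * c j) *s \<omega> j"
      using j by simp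
    finally show "f x = 0"
      using c_nonzero[OF j(1)] \<omega>_nonzero[OF j(1)] by simp
  qed simp
  have span: "span (\<omega> ` {1..r}) = eHe J"
  proof
    have "subspace (eHe J)"
      unfolding subspace_def eHe_def
    proof (intro conjI ballI allI)
      show "0 \<in> {e J * h * e J | h. True}" by (auto intro!: exI[of _ 0])
      fix x assume "x \<in> {e J * h * e J | h. True}"
      then obtain h where h: "x = e J * h * e J" by blast
      then show "a *s x \<in> {e J * h * e J | h. True}" for a
        by (auto intro!: exI[of _ "a *s h"] simp: scale_mult_left scale_mult_right)
      fix y assume "y \<in> {e J * h * e J | h. True}"
      then obtain k where "y = e J * k * e J" by blast
      with h show "x + y \<in> {e J * h * e J | h. True}"
        by (auto intro!: exI[of _ "h + k"] simp: distrib_left distrib_right)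
    qed
    then show "span (\<omega> ` {1..r}) \<subseteq> eHe J"
      using eHe by (intro span_minimal) auto
    show "eHe J \<subseteq> span (\<omega> ` {1..r})"
    proof
      fix x assume "x \<in> eHe J"
      then obtain h where x: "x = e J * h * e J" unfolding eHe_def by blast
      \<comment> \<open>Only the left factor \<open>e J\<close> is expanded; the right one is kept
        so that the fact \<open>corner\<close> applies.\<close>
      have "x = (\<Sum>i\<in>{1..r}. d i * h * e J)"
        unfolding x by (subst (1) d_sum) (simp add: sum_distrib_right)
      \<comment> \<open>The divisor comes from \<open>\<omega> i = c i *s d i\<close>, solved for
        \<open>d i\<close>.\<close>
      also have "\<dots> = (\<Sum>i\<in>{1..r}. (\<kappa> i h / c i) *s \<omega> i)"
        using corner \<omega> c_nonzero by (intro sum.cong) auto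
      also have "\<dots> \<in> span (\<omega> ` {1..r})"
        by (intro span_sum span_scale span_base imageI)
      finally show "x \<in> span (\<omega> ` {1..r})" .
    qed
  qed
  have V: "\<omega> i \<in> V i" if "i \<in> {1..r}" for i
    using V_eq[OF that] dd[OF that that] \<omega>[OF that] by (simp add: scale_mult_right)
  have coeff: "a \<one> = 1" if "i \<in> {1..r}" "\<omega> i = (\<Sum>w \<in> carrier W. a w *s Tw w)" for i a
    using trace[OF that(1)] trace_form_expansion[of a] that(2) by simp
  show ?thesis
    using \<omega>_comm Tw_expansion coeff mult eHe V inj indep span by blast
qed

end
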